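(* Let $S=\mathcal{PD}_K(\phi,f)$ be a transversal Poncelet-Darboux curve of degree $n-1$ with respect to the conic $K$, where $\phi$ and $f$ are complex polynomials of degree $n$ without common zeros. For a value $t$ write $\Phi_t(z)=\phi(z)+tf(z)$. (i) If $n=2k+1$ and $S$ is completely decomposed into $k$ conics, then there exist four distinct values $t_1,t_2,t_3,t_4$ such that $$\deg\gcd\Big(\Phi_{t_i}(z),\frac{d}{dz}\Phi_{t_i}(z)\Big)=k,\qquad i=1,2,3,4.$$ (ii) If $n=2k$ and $S$ is completely decomposed into $k-1$ conics and a line, then there exist four distinct values $t_1,t_2,t_3,t_4$ such that $$\deg\gcd\Big(\Phi_{t_i}(z),\frac{d}{dz}\Phi_{t_i}(z)\Big)=k,\quad i=1,2,\qquad \deg\gcd\Big(\Phi_{t_i}(z),\frac{d}{dz}\Phi_{t_i}(z)\Big)=k-1,\quad i=3,4.$$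
   Context: $K$ is the conic $z_1^2=4z_0z_2$ in $\mathbb{CP}^2$ with homogeneous coordinates $(z_0,z_1,z_2)$; its tangent lines are $z_2s^2+z_1s+z_0=0$. The Darboux coordinates $(\rho,\rho_1)$ of a point $(z_0,z_1,z_2)$ are the two roots in $s$ of $z_2s^2+z_1s+z_0=0$, i.e. $z_0/(\rho\rho_1)=-z_1/(\rho+\rho_1)=z_2$. The Poncelet-Darboux curve $\mathcal{PD}_K(\phi,f)$ is the curve of degree $n-1$ given in Darboux coordinates by $f(\rho)/\phi(\rho)=f(\rho_1)/\phi(\rho_1)$ with the factor $\rho-\rho_1$ removed, i.e. by $\dfrac{\phi(\rho)f(\rho_1)-\phi(\rho_1)f(\rho)}{\rho-\rho_1}=0$ (a symmetric polynomial of degree $n-1$ in each variable, hence a form of degree $n-1$ in $z_0,z_1,z_2$). Such a curve is called transversal if it intersects $K$ transversally at every intersection point; equivalently (for $\phi,f$ without common zeros), every polynomial in the pencil generated by $\phi$ and $f$ has roots of multiplicity at most $2$. "Conics" in a complete decomposition are irreducible conics; complete decomposition means that $S$ is the union of the indicated curves.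
   Formalization: The claim fails as printed in three cases, so: t may be infinite (the member is then f); a double root at infinity of a member of lower degree counts in deg gcd; and in (ii) with k=4 the alternative of five distinct values with gcd degrees 4,4,4,1,1 is allowed. *)

theory Defs
  imports "HOL-Analysis.Analysis" "HOL-Computational_Algebra.Polynomial_Factorial"
    "HOL-Computational_Algebra.Field_as_Ring"
begin

section \<open>Plane projective curves\<close>

text \<open>Ternary forms are represented by their polynomial functions on \<open>\<complex>\<^sup>3\<close>; over an infinite
  field a form is determined by its function. The zero form has every degree.\<close>

type_synonym form = "complex \<Rightarrow> complex \<Rightarrow> complex \<Rightarrow> complex"

definition is_form :: "nat \<Rightarrow> form \<Rightarrow> bool" where
  "is_form d F \<longleftrightarrow> (\<exists>c :: nat \<Rightarrow> nat \<Rightarrow> complex. \<forall>z0 z1 z2.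
     F z0 z1 z2 = (\<Sum>i\<le>d. \<Sum>j\<le>d - i. c i j * z0 ^ i * z1 ^ j * z2 ^ (d - i - j)))"

text \<open>Point sets in \<open>\<complex>\<P>\<^sup>2\<close> are given by all their nonzero homogeneous coordinate vectors.\<close>

definition curve :: "form \<Rightarrow> (complex \<times> complex \<times> complex) set" where
  "curve F = {(z0, z1, z2). (z0, z1, z2) \<noteq> (0, 0, 0) \<and> F z0 z1 z2 = 0}"

definition is_line :: "form \<Rightarrow> bool" where
  "is_line L \<longleftrightarrow> is_form 1 L \<and> (\<exists>z0 z1 z2. L z0 z1 z2 \<noteq> 0)"

text \<open>A linear form may be zero here, so the zero form is not an irreducible conic.\<close>

definition irreducible_conic :: "form \<Rightarrow> bool" where
  "irreducible_conic C \<longleftrightarrow> is_form 2 C \<and>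
     \<not> (\<exists>L M. is_form 1 L \<and> is_form 1 M \<and> (\<forall>z0 z1 z2. C z0 z1 z2 = L z0 z1 z2 * M z0 z1 z2))"

definition partial0 :: "form \<Rightarrow> form" where
  "partial0 F z0 z1 z2 = deriv (\<lambda>w. F w z1 z2) z0"

definition partial1 :: "form \<Rightarrow> form" where
  "partial1 F z0 z1 z2 = deriv (\<lambda>w. F z0 w z2) z1"

definition partial2 :: "form \<Rightarrow> form" where
  "partial2 F z0 z1 z2 = deriv (\<lambda>w. F z0 z1 w) z2"

text \<open>Two curves meet transversally at a common point iff both are smooth there with different
  tangent lines, i.e. iff the gradients of their equations are linearly independent.\<close>

definition transversal_curves :: "form \<Rightarrow> form \<Rightarrow> bool" where
  "transversal_curves F G \<longleftrightarrow> (\<forall>(z0, z1, z2) \<in> curve F \<inter> curve G. \<forall>a b :: complex.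
     a * partial0 F z0 z1 z2 + b * partial0 G z0 z1 z2 = 0 \<and>
     a * partial1 F z0 z1 z2 + b * partial1 G z0 z1 z2 = 0 \<and>
     a * partial2 F z0 z1 z2 + b * partial2 G z0 z1 z2 = 0 \<longrightarrow> a = 0 \<and> b = 0)"

definition conic_K :: form where
  "conic_K z0 z1 z2 = z1 ^ 2 - 4 * z0 * z2"


section \<open>Poncelet-Darboux curves\<close>

text \<open>With \<open>z\<^sub>2 = 1\<close> the point with Darboux coordinates \<open>(\<rho>, \<rho>\<^sub>1)\<close> is
  \<open>(\<rho>\<rho>\<^sub>1, -(\<rho> + \<rho>\<^sub>1), 1)\<close>. Existence and uniqueness of the form are shown in
  \<open>poncelet_darboux_form_ex1\<close> below.\<close>

definition poncelet_darboux_form :: "nat \<Rightarrow> complex poly \<Rightarrow> complex poly \<Rightarrow> form \<Rightarrow> bool" where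
  "poncelet_darboux_form n \<phi> f F \<longleftrightarrow> is_form (n - 1) F \<and>
     (\<forall>\<rho> \<rho>1. (\<rho> - \<rho>1) * F (\<rho> * \<rho>1) (- (\<rho> + \<rho>1)) 1 =
        poly \<phi> \<rho> * poly f \<rho>1 - poly \<phi> \<rho>1 * poly f \<rho>)"

definition is_union_of_conics :: "form \<Rightarrow> nat \<Rightarrow> bool" where
  "is_union_of_conics F k \<longleftrightarrow> (\<exists>C :: nat \<Rightarrow> form.
     (\<forall>i<k. irreducible_conic (C i)) \<and> curve F = (\<Union>i<k. curve (C i)))"

definition is_union_of_conics_and_line :: "form \<Rightarrow> nat \<Rightarrow> bool" where
  "is_union_of_conics_and_line F k \<longleftrightarrow> (\<exists>(C :: nat \<Rightarrow> form) L.
     (\<forall>i<k. irreducible_conic (C i)) \<and> is_line L \<and>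
     curve F = (\<Union>i<k. curve (C i)) \<union> curve L)"


section \<open>Members of the pencil\<close>

text \<open>The parameter ranges over the projective line: \<open>None\<close> is the value \<open>\<infinity>\<close>, whose member is
  \<open>f\<close>.\<close>

fun pencil :: "complex poly \<Rightarrow> complex poly \<Rightarrow> complex option \<Rightarrow> complex poly" where
  "pencil \<phi> f (Some t) = \<phi> + smult t f"
| "pencil \<phi> f None = f"

text \<open>The degree of \<open>gcd p p'\<close> for \<open>p\<close> regarded as a binary form of degree \<open>n\<close>, i.e. the degree of
  the gcd of the two partial derivatives of that form. The form has \<open>\<infinity>\<close> as a root of
  multiplicity \<open>n - degree p\<close>, which adds \<open>n - degree p - 1\<close> (truncated at 0).\<close>

definition gcd_degree :: "nat \<Rightarrow> complex poly \<Rightarrow> nat" where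
  "gcd_degree n p = degree (gcd p (pderiv p)) + (n - degree p - 1)"

lemma gcd_degree_no_multiple_root_at_infinity:
  assumes "n \<le> degree p + 1"
  shows "gcd_degree n p = degree (gcd p (pderiv p))"
  using assms by (simp add: gcd_degree_def)


section \<open>Existence and uniqueness of the Poncelet-Darboux form\<close>

lemma is_form_0: "is_form d (\<lambda>z0 z1 z2. 0)"
  unfolding is_form_def by (rule exI[of _ "\<lambda>i j. 0"]) simp

lemma is_form_1: "is_form 0 (\<lambda>z0 z1 z2. 1)"
  unfolding is_form_def by (rule exI[of _ "\<lambda>i j. 1"]) simp

lemma is_form_add:
  assumes "is_form d F" "is_form d G"
  shows "is_form d (\<lambda>z0 z1 z2. F z0 z1 z2 + G z0 z1 z2)"
proof -
  obtain a b where
    "\<forall>z0 z1 z2. F z0 z1 z2 = (\<Sum>i\<le>d. \<Sum>j\<le>d - i. a i j * z0 ^ i * z1 ^ j * z2 ^ (d - i - j))"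
    "\<forall>z0 z1 z2. G z0 z1 z2 = (\<Sum>i\<le>d. \<Sum>j\<le>d - i. b i j * z0 ^ i * z1 ^ j * z2 ^ (d - i - j))"
    using assms unfolding is_form_def by blast
  then show ?thesis
    unfolding is_form_def
    by (intro exI[of _ "\<lambda>i j. a i j + b i j"]) (simp add: sum.distrib algebra_simps)
qed

lemma is_form_scale:
  assumes "is_form d F"
  shows "is_form d (\<lambda>z0 z1 z2. r * F z0 z1 z2)"
proof -
  obtain a where
    "\<forall>z0 z1 z2. F z0 z1 z2 = (\<Sum>i\<le>d. \<Sum>j\<le>d - i. a i j * z0 ^ i * z1 ^ j * z2 ^ (d - i - j))"
    using assms unfolding is_form_def by blast
  then show ?thesis
    unfolding is_form_def
    by (intro exI[of _ "\<lambda>i j. r * a i j"]) (simp add: sum_distrib_left algebra_simps)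
qed

lemma is_form_sum:
  assumes "\<And>i. i \<in> A \<Longrightarrow> is_form d (F i)"
  shows "is_form d (\<lambda>z0 z1 z2. \<Sum>i\<in>A. F i z0 z1 z2)"
  using assms
  by (induction A rule: infinite_finite_induct) (auto intro: is_form_0 is_form_add)

lemma is_form_mult_z0:
  assumes "is_form d F"
  shows "is_form (Suc d) (\<lambda>z0 z1 z2. z0 * F z0 z1 z2)"
proof -
  obtain a where a:
    "\<forall>z0 z1 z2. F z0 z1 z2 = (\<Sum>i\<le>d. \<Sum>j\<le>d - i. a i j * z0 ^ i * z1 ^ j * z2 ^ (d - i - j))"
    using assms unfolding is_form_def by blast
  define b where "b = (\<lambda>i j. if i = 0 then 0 else a (i - 1) j)"
  have "z0 * F z0 z1 z2 =
      (\<Sum>i\<le>Suc d. \<Sum>j\<le>Suc d - i. b i j * z0 ^ i * z1 ^ j * z2 ^ (Suc d - i - j))" for z0 z1 z2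
    unfolding sum.atMost_Suc_shift[of _ d] a[rule_format]
    by (simp add: b_def sum_distrib_left mult_ac)
  then show ?thesis
    unfolding is_form_def by blast
qed

lemma is_form_mult_z1:
  assumes "is_form d F"
  shows "is_form (Suc d) (\<lambda>z0 z1 z2. z1 * F z0 z1 z2)"
proof -
  obtain a where a:
    "\<forall>z0 z1 z2. F z0 z1 z2 = (\<Sum>i\<le>d. \<Sum>j\<le>d - i. a i j * z0 ^ i * z1 ^ j * z2 ^ (d - i - j))"
    using assms unfolding is_form_def by blast
  define b where "b = (\<lambda>i j. if j = 0 then 0 else a i (j - 1))"
  have "(\<Sum>j\<le>Suc d - i. b i j * z0 ^ i * z1 ^ j * z2 ^ (Suc d - i - j)) =
      z1 * (\<Sum>j\<le>d - i. a i j * z0 ^ i * z1 ^ j * z2 ^ (d - i - j))"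
    if "i \<le> d" for i and z0 z1 z2 :: complex
    using that
    by (simp add: Suc_diff_le sum.atMost_Suc_shift b_def sum_distrib_left algebra_simps del: sum.atMost_Suc)
  then have "\<forall>z0 z1 z2. z1 * F z0 z1 z2 =
      (\<Sum>i\<le>Suc d. \<Sum>j\<le>Suc d - i. b i j * z0 ^ i * z1 ^ j * z2 ^ (Suc d - i - j))"
    using a by (simp add: b_def sum_distrib_left)
  then show ?thesis
    unfolding is_form_def by blast
qed

lemma is_form_mult_z2:
  assumes "is_form d F"
  shows "is_form (Suc d) (\<lambda>z0 z1 z2. z2 * F z0 z1 z2)"
proof -
  obtain a where a:
    "\<forall>z0 z1 z2. F z0 z1 z2 = (\<Sum>i\<le>d. \<Sum>j\<le>d - i. a i j * z0 ^ i * z1 ^ j * z2 ^ (d - i - j))"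
    using assms unfolding is_form_def by blast
  define b where "b = (\<lambda>i j. if i + j \<le> d then a i j else 0)"
  have "(\<Sum>j\<le>Suc d - i. b i j * z0 ^ i * z1 ^ j * z2 ^ (Suc d - i - j)) =
      z2 * (\<Sum>j\<le>d - i. a i j * z0 ^ i * z1 ^ j * z2 ^ (d - i - j))"
    if i: "i \<le> d" for i and z0 z1 z2 :: complex
  proof -
    have "b i j * z0 ^ i * z1 ^ j * z2 ^ (Suc d - i - j) =
        z2 * (a i j * z0 ^ i * z1 ^ j * z2 ^ (d - i - j))" if "j \<le> d - i" for j
    proof -
      have "Suc d - i - j = Suc (d - i - j)" "i + j \<le> d"
        using i that by auto
      then show ?thesis by (simp add: b_def)
    qed
    then have "(\<Sum>j\<le>d - i. b i j * z0 ^ i * z1 ^ j * z2 ^ (Suc d - i - j)) =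
        z2 * (\<Sum>j\<le>d - i. a i j * z0 ^ i * z1 ^ j * z2 ^ (d - i - j))"
      unfolding sum_distrib_left by (intro sum.cong refl) simp
    moreover have "b i (Suc (d - i)) = 0"
      using i by (simp add: b_def)
    ultimately show ?thesis
      using i by (simp add: Suc_diff_le)
  qed
  then have "\<forall>z0 z1 z2. z2 * F z0 z1 z2 =
      (\<Sum>i\<le>Suc d. \<Sum>j\<le>Suc d - i. b i j * z0 ^ i * z1 ^ j * z2 ^ (Suc d - i - j))"
    using a by (simp add: b_def sum_distrib_left)
  then show ?thesis
    unfolding is_form_def by blast
qed

lemma complete_symmetric_form:
  "\<exists>H. is_form m H \<and> (\<forall>x y. (x - y) * H (x * y) (- (x + y)) 1 = x ^ Suc m - y ^ Suc m)"
proof (induction m rule: less_induct)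
  case (less m)
  consider "m = 0" | "m = 1" | l where "m = Suc (Suc l)"
    by (metis One_nat_def not0_implies_Suc)
  then show ?case
  proof cases
    case 1
    then show ?thesis
      by (intro exI[of _ "\<lambda>z0 z1 z2. 1"]) (simp add: is_form_1)
  next
    case 2
    have "is_form (Suc 0) (\<lambda>z0 z1 z2. (- 1) * (z1 * 1))"
      by (intro is_form_scale is_form_mult_z1 is_form_1)
    with 2 show ?thesis
      by (intro exI[of _ "\<lambda>z0 z1 z2. (- 1) * (z1 * 1)"]) (simp add: algebra_simps)
  next
    case 3
    obtain H G where H: "is_form (Suc l) H"
        "\<forall>x y. (x - y) * H (x * y) (- (x + y)) 1 = x ^ Suc (Suc l) - y ^ Suc (Suc l)"
      and G: "is_form l G"
        "\<forall>x y. (x - y) * G (x * y) (- (x + y)) 1 = x ^ Suc l - y ^ Suc l"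
      using less[of "Suc l"] less[of l] 3 by auto
    define E where
      "E = (\<lambda>z0 z1 z2. (- 1) * (z1 * H z0 z1 z2) + (- 1) * (z0 * (z2 * G z0 z1 z2)))"
    have "is_form m E"
      unfolding E_def 3
      by (intro is_form_add is_form_scale is_form_mult_z0 is_form_mult_z1 is_form_mult_z2 H G)
    moreover have "(x - y) * E (x * y) (- (x + y)) 1 = x ^ Suc m - y ^ Suc m" for x y
    proof -
      have "(x - y) * E (x * y) (- (x + y)) 1 =
          (x + y) * ((x - y) * H (x * y) (- (x + y)) 1)
          - x * y * ((x - y) * G (x * y) (- (x + y)) 1)"
        unfolding E_def by (simp add: algebra_simps)
      also have "\<dots> = x ^ Suc m - y ^ Suc m"
        unfolding H(2)[rule_format] G(2)[rule_format] 3 by (simp add: algebra_simps)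
      finally show ?thesis .
    qed
    ultimately show ?thesis by blast
  qed
qed

lemma is_form_mult_powers:
  assumes "is_form d F"
  shows "is_form (p + q + d) (\<lambda>z0 z1 z2. z0 ^ p * (z2 ^ q * F z0 z1 z2))"
proof -
  have "is_form (q + d) (\<lambda>z0 z1 z2. z2 ^ q * F z0 z1 z2)"
    by (induction q) (use assms in \<open>auto dest: is_form_mult_z2 simp: mult.assoc\<close>)
  then show ?thesis
    by (induction p) (auto dest: is_form_mult_z0 simp: mult.assoc)
qed

lemma darboux_monomial:
  assumes "i \<le> n" "j \<le> n" "1 \<le> n"
  shows "\<exists>G. is_form (n - 1) G \<and>
    (\<forall>x y. (x - y) * G (x * y) (- (x + y)) 1 = x ^ j * y ^ i - y ^ j * x ^ i)"
proof -
  have less: "\<exists>G. is_form (n - 1) G \<and>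
      (\<forall>x y. (x - y) * G (x * y) (- (x + y)) 1 = x ^ b * y ^ a - y ^ b * x ^ a)"
    if "a < b" "b \<le> n" for a b
  proof -
    define m where "m = b - a - 1"
    obtain H where H: "is_form m H"
      "\<forall>x y. (x - y) * H (x * y) (- (x + y)) 1 = x ^ Suc m - y ^ Suc m"
      using complete_symmetric_form by blast
    have b: "b = a + Suc m"
      using that by (simp add: m_def)
    define G where "G = (\<lambda>z0 z1 z2. z0 ^ a * (z2 ^ (n - b) * H z0 z1 z2))"
    have "a + (n - b) + m = n - 1"
      using that b by simp
    then have "is_form (n - 1) G"
      using is_form_mult_powers[OF H(1), of a "n - b"] by (simp add: G_def)
    moreover have "(x - y) * G (x * y) (- (x + y)) 1 = x ^ b * y ^ a - y ^ b * x ^ a" for x y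
    proof -
      have "(x - y) * G (x * y) (- (x + y)) 1 =
          (x * y) ^ a * ((x - y) * H (x * y) (- (x + y)) 1)"
        by (simp add: G_def)
      also have "\<dots> = x ^ b * y ^ a - y ^ b * x ^ a"
        unfolding H(2)[rule_format] b by (simp add: algebra_simps power_mult_distrib power_add)
      finally show ?thesis .
    qed
    ultimately show ?thesis by blast
  qed
  consider "i < j" | "i = j" | "j < i" by linarith
  then show ?thesis
  proof cases
    case 1
    then show ?thesis using less assms by blast
  next
    case 2
    then show ?thesis
      by (intro exI[of _ "\<lambda>z0 z1 z2. 0"]) (simp add: is_form_0)
  next
    case 3
    then obtain G where G: "is_form (n - 1) G"
      "\<forall>x y. (x - y) * G (x * y) (- (x + y)) 1 = x ^ i * y ^ j - y ^ i * x ^ j"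
      using less assms by blast
    show ?thesis
    proof (intro exI[of _ "\<lambda>z0 z1 z2. (- 1) * G z0 z1 z2"] conjI allI)
      show "is_form (n - 1) (\<lambda>z0 z1 z2. (- 1) * G z0 z1 z2)"
        by (rule is_form_scale[OF G(1)])
      fix x y
      have "(x - y) * (- 1 * G (x * y) (- (x + y)) 1) = - ((x - y) * G (x * y) (- (x + y)) 1)"
        by simp
      then show "(x - y) * (- 1 * G (x * y) (- (x + y)) 1) = x ^ j * y ^ i - y ^ j * x ^ i"
        unfolding G(2)[rule_format] by (simp add: algebra_simps)
    qed
  qed
qed

lemma poncelet_darboux_form_exists:
  assumes "1 \<le> n" "degree \<phi> \<le> n" "degree f \<le> n"
  shows "\<exists>F. poncelet_darboux_form n \<phi> f F"
proof -
  have "\<forall>i j. \<exists>G. i \<le> n \<and> j \<le> n \<longrightarrow> is_form (n - 1) G \<and>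
    (\<forall>x y. (x - y) * G (x * y) (- (x + y)) 1 = x ^ j * y ^ i - y ^ j * x ^ i)"
    using darboux_monomial[OF _ _ assms(1)] by blast
  then obtain G where G: "\<And>i j. i \<le> n \<Longrightarrow> j \<le> n \<Longrightarrow> is_form (n - 1) (G i j)"
    "\<And>i j x y. i \<le> n \<Longrightarrow> j \<le> n \<Longrightarrow>
      (x - y) * G i j (x * y) (- (x + y)) 1 = x ^ j * y ^ i - y ^ j * x ^ i"
    by metis
  define F where
    "F = (\<lambda>z0 z1 z2. \<Sum>j\<in>{..n}. \<Sum>i\<in>{..n}. (coeff \<phi> j * coeff f i) * G i j z0 z1 z2)"
  have poly_n: "poly p x = (\<Sum>i\<le>n. coeff p i * x ^ i)" if "degree p \<le> n" for p and x :: complex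
    using that by (simp add: poly_altdef) (rule sum.mono_neutral_left; simp add: coeff_eq_0)
  have "is_form (n - 1) F"
    unfolding F_def by (intro is_form_sum is_form_scale G) auto
  moreover have "(x - y) * F (x * y) (- (x + y)) 1 =
      poly \<phi> x * poly f y - poly \<phi> y * poly f x" for x y
  proof -
    have "(x - y) * F (x * y) (- (x + y)) 1 =
        (\<Sum>j\<le>n. \<Sum>i\<le>n. (coeff \<phi> j * coeff f i) * ((x - y) * G i j (x * y) (- (x + y)) 1))"
      unfolding F_def by (simp add: sum_distrib_left mult_ac)
    also have "\<dots> =
        (\<Sum>j\<le>n. \<Sum>i\<le>n. (coeff \<phi> j * coeff f i) * (x ^ j * y ^ i - y ^ j * x ^ i))"
      by (intro sum.cong refl) (simp only: G atMost_iff)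
    also have "\<dots> = poly \<phi> x * poly f y - poly \<phi> y * poly f x"
      unfolding poly_n[OF assms(2)] poly_n[OF assms(3)] sum_product
      by (simp add: sum_subtractf algebra_simps)
    finally show ?thesis .
  qed
  ultimately show ?thesis
    unfolding poncelet_darboux_form_def by blast
qed

lemma poncelet_darboux_form_unique:
  assumes "poncelet_darboux_form n \<phi> f F" "poncelet_darboux_form n \<phi> f G"
  shows "F = G"
proof -
  define d where "d = n - 1"
  have "is_form d (\<lambda>z0 z1 z2. F z0 z1 z2 + (- 1) * G z0 z1 z2)"
    using assms unfolding poncelet_darboux_form_def d_def
    by (intro is_form_add is_form_scale) auto
  then obtain c where c: "F z0 z1 z2 - G z0 z1 z2 =
      (\<Sum>i\<le>d. \<Sum>j\<le>d - i. c i j * z0 ^ i * z1 ^ j * z2 ^ (d - i - j))" for z0 z1 z2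
    unfolding is_form_def by auto
  have zero: "F z0 z1 1 = G z0 z1 1" if ne: "z0 \<noteq> z1 ^ 2 / 4" for z0 z1
  proof -
    define s where "s = csqrt (z1 ^ 2 - 4 * z0)"
    have s: "s ^ 2 = z1 ^ 2 - 4 * z0"
      by (simp add: s_def)
    then have "s \<noteq> 0"
      using ne by (auto simp: field_simps)
    define x y where "x = (s - z1) / 2" and "y = (- s - z1) / 2"
    have "x * y = (z1 ^ 2 - s ^ 2) / 4"
      by (simp add: x_def y_def field_simps power2_eq_square)
    then have "x * y = z0" "- (x + y) = z1" "x - y = s"
      by (auto simp: s x_def y_def field_simps)
    moreover have "(x - y) * F (x * y) (- (x + y)) 1 = (x - y) * G (x * y) (- (x + y)) 1"
      using assms unfolding poncelet_darboux_form_def by metis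
    ultimately show ?thesis
      using \<open>s \<noteq> 0\<close> by simp
  qed
  have "(\<Sum>j\<le>d - i. c i j * z1 ^ j) = 0" if "i \<le> d" for i z1
  proof (rule ccontr)
    define a where "a = (\<lambda>i. \<Sum>j\<le>d - i. c i j * z1 ^ j)"
    assume "(\<Sum>j\<le>d - i. c i j * z1 ^ j) \<noteq> 0"
    then have "a i \<noteq> 0" by (simp add: a_def)
    then have "finite {z0. (\<Sum>i\<le>d. a i * z0 ^ i) = 0}"
      using that polyfun_finite_roots[of a d] by blast
    moreover have "- {z1 ^ 2 / 4} \<subseteq> {z0. (\<Sum>i\<le>d. a i * z0 ^ i) = 0}"
    proof
      fix z0 assume "z0 \<in> - {z1 ^ 2 / 4}"
      then have "F z0 z1 1 - G z0 z1 1 = 0"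
        using zero by simp
      then show "z0 \<in> {z0. (\<Sum>i\<le>d. a i * z0 ^ i) = 0}"
        unfolding c by (simp add: a_def sum_distrib_left mult_ac)
    qed
    ultimately have "finite (- {z1 ^ 2 / 4})"
      by (rule rev_finite_subset)
    then show False
      using infinite_UNIV_char_0[where 'a = complex] by simp
  qed
  then have "c i j = 0" if "i \<le> d" "j \<le> d - i" for i j
    using that polyfun_eq_0[of "c i" "d - i"] by blast
  then have "F z0 z1 z2 - G z0 z1 z2 = 0" for z0 z1 z2
    unfolding c by simp
  then show ?thesis
    by (intro ext) simp
qed

lemma poncelet_darboux_form_ex1:
  assumes "1 \<le> n" "degree \<phi> \<le> n" "degree f \<le> n"
  shows "\<exists>!F. poncelet_darboux_form n \<phi> f F"
  using poncelet_darboux_form_exists[OF assms] poncelet_darboux_form_unique by blast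

end

theory Submission
  imports Defs "HOL-Computational_Algebra.Fundamental_Theorem_Algebra"
begin

text \<open>
  Let \<open>w = \<phi>'f - \<phi>f'\<close>, the restriction of the equation of \<open>S\<close> to \<open>K\<close>. Transversality means that its
  \<open>2n - 2\<close> zeros in \<open>\<complex>\<P>\<^sup>1\<close> are simple, so a member \<open>\<Phi>\<^sub>t\<close> of the pencil has only simple and double roots,
  the double ones being the zeros of \<open>w\<close> in its fibre. If \<open>\<mu>\<^sub>t\<close> is their number, which is
  \<open>deg gcd(\<Phi>\<^sub>t, \<Phi>\<^sub>t')\<close>, then \<open>\<Sum>\<^sub>t \<mu>\<^sub>t = 2n - 2\<close>.

  On the tangent line of \<open>K\<close> with parameter \<open>x\<close>, the curve cuts out the points \<open>y \<noteq> x\<close> of the fibre of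
  \<open>x\<close>. If \<open>x\<close> is a simple and \<open>y\<close> a double root of the same member, this tangent line touches the
  curve at \<open>{x, y}\<close>, where the curve is smooth; hence it touches exactly one component, which is a conic.
  Conversely each conic has four distinct common tangents with \<open>K\<close>, and each of these comes from such a
  pair. Counting the pairs for \<open>m\<close> conics gives \<open>\<Sum>\<^sub>t \<mu>\<^sub>t (n - 2\<mu>\<^sub>t) = 4m\<close>, and these two equations leave only
  the stated possibilities.
\<close>

text \<open>Complete decomposition is an equality of point sets and says nothing about
  multiplicities, so it must first become an identity of equations. A degree count does this: the
  components have total degree \<open>n - 1\<close>, and a generic tangent line of K meets the curve
  in \<open>n - 1\<close> distinct points, so on that line the product of the component equations
  has no room for other zeros and is a multiple of the equation of the curve. On a fixed tangent
  line everything is a polynomial in one variable, whose degree may drop at special parameters; such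
  a drop is a zero at infinity. To keep infinity out of the counts, a Moebius transformation moves a
  generic point there. It acts linearly on CP^2 and preserves K, and the number of distinct zeros in
  CP^1 carries the result back. The arithmetic of the even case has one solution more than the
  English statement, the multiplicities 4, 4, 4, 1, 1 for \<open>k = 4\<close>; hence the second
  alternative in the conclusion.\<close>

section \<open>Binary forms and Moebius transformations\<close>

lemma sum_order_eq_degree:
  fixes p :: "complex poly"
  assumes "p \<noteq> 0"
  shows "(\<Sum>x | poly p x = 0. order x p) = degree p"
  using size_proots_complex[of p] assms by (simp add: size_multiset_overloaded_eq)

lemma rsquarefree_card_roots:
  fixes p :: "complex poly"
  assumes "rsquarefree p"
  shows "card {x. poly p x = 0} = degree p"
proof -
  have "p \<noteq> 0"
    using assms by (simp add: rsquarefree_def)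
  then have "(\<Sum>x | poly p x = 0. order x p) = (\<Sum>x | poly p x = 0. 1)"
    using assms by (intro sum.cong) (auto dest: rsquarefree_root_order)
  then show ?thesis
    using sum_order_eq_degree[OF \<open>p \<noteq> 0\<close>] by simp
qed

text \<open>In characteristic 0 the quotient of \<open>p\<close> by the gcd has the roots of
  \<open>p\<close>, all simple, so its degree counts them. Constants are treated apart because the
  squarefree decomposition needs \<open>pderiv p \<noteq> 0\<close>.\<close>

lemma degree_gcd_pderiv:
  fixes p :: "complex poly"
  assumes "p \<noteq> 0"
  shows "degree (gcd p (pderiv p)) + card {x. poly p x = 0} = degree p"
proof (cases "pderiv p = 0")
  case True
  then have "degree p = 0"
    by (simp add: pderiv_eq_0_iff)
  then obtain c where c: "p = [:c:]"
    by (metis degree_eq_zeroE)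
  have "degree (gcd p (pderiv p)) \<le> degree p"
    by (rule dvd_imp_degree_le[OF gcd_dvd1 assms])
  with assms c show ?thesis
    by simp
next
  case False
  define d where "d = gcd p (pderiv p)"
  obtain q where q: "p = q * d"
    using gcd_dvd1[of p "pderiv p"] unfolding d_def dvd_def by (metis mult.commute)
  obtain e where e: "pderiv p = e * d"
    using gcd_dvd2[of p "pderiv p"] unfolding d_def dvd_def by (metis mult.commute)
  obtain r s where "d = r * p + s * pderiv p"
    using bezout_coefficients_fst_snd[of p "pderiv p"] unfolding d_def by metis
  note sq = poly_squarefree_decomp[OF False q e this]
  have "q \<noteq> 0" "d \<noteq> 0"
    using assms q by auto
  have "card {x. poly q x = 0} = degree q"
    using sq rsquarefree_card_roots by blast
  moreover have "card {x. poly q x = 0} = card {x. poly p x = 0}"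
    using sq by simp
  moreover have "degree p = degree q + degree d"
    using trans[OF arg_cong[OF q, of degree] degree_mult_eq[OF \<open>q \<noteq> 0\<close> \<open>d \<noteq> 0\<close>]] .
  ultimately show ?thesis
    unfolding d_def[symmetric] by linarith
qed

text \<open>The number of distinct zeros in \<open>\<complex>\<P>\<^sup>1\<close> of \<open>p\<close> as a binary form of degree \<open>n\<close>. Unlike the number
  of zeros in \<open>\<complex>\<close> it is invariant under Moebius transformations.\<close>

definition proj_roots :: "nat \<Rightarrow> complex poly \<Rightarrow> nat" where
  "proj_roots n p = card {x. poly p x = 0} + (if degree p < n then 1 else 0)"

text \<open>A zero at infinity of multiplicity r >= 1 adds r - 1 to \<open>gcd_degree\<close> and 1
  to \<open>proj_roots\<close>; if infinity is no zero, both add 0.\<close>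

lemma gcd_degree_add_proj_roots:
  assumes "p \<noteq> 0" "degree p \<le> n"
  shows "gcd_degree n p + proj_roots n p = n"
  using degree_gcd_pderiv[OF assms(1)] assms(2) unfolding gcd_degree_def proj_roots_def by auto

text \<open>The polynomial \<open>x\<^sup>n p(e - 1/x)\<close>.\<close>

definition moebius_poly :: "nat \<Rightarrow> complex \<Rightarrow> complex poly \<Rightarrow> complex poly" where
  "moebius_poly n e p = monom 1 (n - degree p) * reflect_poly (pcompose p [:e, -1:])"

lemma degree_pcompose_reflection [simp]:
  "degree (pcompose p [:e, -1:]) = degree p" for p :: "complex poly"
  by (simp add: degree_pcompose)

lemma pcompose_reflection_eq_0_iff [simp]:
  "pcompose p [:e, -1:] = 0 \<longleftrightarrow> p = 0" for p :: "complex poly"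
  by (rule pcompose_eq_0_iff) simp

lemma poly_moebius:
  assumes "degree p \<le> n" "x \<noteq> 0"
  shows "poly (moebius_poly n e p) x = x ^ n * poly p (e - 1 / x)"
proof -
  have "x ^ n = x ^ (n - degree p) * x ^ degree p"
    using assms by (simp flip: power_add)
  then show ?thesis
    using assms
    by (simp add: moebius_poly_def poly_monom poly_reflect_poly_nz poly_pcompose field_simps)
qed

lemma poly_eqI_nonzero:
  fixes p q :: "complex poly"
  assumes "\<And>x. x \<noteq> 0 \<Longrightarrow> poly p x = poly q x"
  shows "p = q"
proof -
  have "poly (monom 1 1 * p) x = poly (monom 1 1 * q) x" for x
    using assms by (cases "x = 0") (auto simp: poly_monom)
  then have "monom 1 1 * p = monom 1 1 * q"
    by (auto simp: poly_eq_poly_eq_iff[symmetric])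
  then show ?thesis
    by (metis mult_cancel_left monom_eq_0_iff one_neq_zero)
qed

lemma moebius_eq_0_iff: "moebius_poly n e p = 0 \<longleftrightarrow> p = 0"
  by (auto simp: moebius_poly_def monom_eq_0_iff)

lemma degree_moebius_le:
  assumes "degree p \<le> n"
  shows "degree (moebius_poly n e p) \<le> n"
  unfolding moebius_poly_def
  using degree_mult_le[of "monom (1::complex) (n - degree p)" "reflect_poly (pcompose p [:e, -1:])"]
    degree_reflect_poly_le[of "pcompose p [:e, -1:]"] degree_monom_le[of "1::complex" "n - degree p"] assms
  by simp

lemma coeff_moebius:
  assumes "degree p \<le> n"
  shows "coeff (moebius_poly n e p) n = poly p e"
proof -
  have "coeff (moebius_poly n e p) n = coeff (reflect_poly (pcompose p [:e, -1:])) (degree p)"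
    using assms by (simp add: moebius_poly_def coeff_monom_mult)
  also have "\<dots> = poly p e"
    by (simp add: coeff_reflect_poly)
  finally show ?thesis .
qed

text \<open>The substitution sends infinity to \<open>e\<close>, so a drop of degree is a zero of
  \<open>p\<close> at \<open>e\<close>.\<close>

lemma degree_moebius_less_iff:
  assumes "degree p \<le> n" "p \<noteq> 0"
  shows "degree (moebius_poly n e p) < n \<longleftrightarrow> n > 0 \<and> poly p e = 0"
  using degree_moebius_le[OF assms(1), of e] coeff_moebius[OF assms(1), of e] assms(2)
  by (metis bot_nat_0.not_eq_extremum coeff_eq_0 leading_coeff_neq_0 le_neq_implies_less less_zeroE
        moebius_eq_0_iff)

lemma poly_moebius_0:
  assumes "p \<noteq> 0" "degree p \<le> n"
  shows "poly (moebius_poly n e p) 0 = 0 \<longleftrightarrow> degree p < n"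
  using assms leading_coeff_0_iff[of "pcompose p [:e, -1:]"]
  by (auto simp: moebius_poly_def poly_monom power_0_left)

text \<open>Away from 0 and infinity the substitution is a bijection onto the finite points other
  than \<open>e\<close>. The point 0 takes over a zero of \<open>p\<close> at infinity, and infinity
  takes over a zero at \<open>e\<close>.\<close>

lemma proj_roots_moebius:
  assumes "degree p \<le> n" "p \<noteq> 0"
  shows "proj_roots n (moebius_poly n e p) = proj_roots n p"
proof (cases "n = 0")
  case True
  with assms obtain c where "p = [:c:]" by (metis degree_eq_zeroE le_zero_eq)
  with True assms show ?thesis
    by (simp add: proj_roots_def moebius_poly_def)
next
  case False
  let ?q = "moebius_poly n e p"
  have fin: "finite {x. poly p x = 0}" "finite {x. poly ?q x = 0}"
    using assms by (auto simp: poly_roots_finite moebius_eq_0_iff)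
  have "bij_betw (\<lambda>x. e - 1 / x) {x. poly ?q x = 0 \<and> x \<noteq> 0} {x. poly p x = 0 \<and> x \<noteq> e}"
    by (rule bij_betwI[of _ _ _ "\<lambda>x. 1 / (e - x)"]) (auto simp: poly_moebius assms)
  then have "card {x. poly ?q x = 0 \<and> x \<noteq> 0} = card {x. poly p x = 0 \<and> x \<noteq> e}"
    by (rule bij_betw_same_card)
  moreover have "card {x. poly ?q x = 0} =
      card {x. poly ?q x = 0 \<and> x \<noteq> 0} + (if poly ?q 0 = 0 then 1 else 0)"
  proof (cases "poly ?q 0 = 0")
    case True
    then have "{x. poly ?q x = 0} = insert 0 {x. poly ?q x = 0 \<and> x \<noteq> 0}" by auto
    then show ?thesis using True fin by simp
  next
    case False
    then have "{x. poly ?q x = 0} = {x. poly ?q x = 0 \<and> x \<noteq> 0}" by auto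
    then show ?thesis using False by simp
  qed
  moreover have "card {x. poly p x = 0} =
      card {x. poly p x = 0 \<and> x \<noteq> e} + (if poly p e = 0 then 1 else 0)"
  proof (cases "poly p e = 0")
    case True
    then have "{x. poly p x = 0} = insert e {x. poly p x = 0 \<and> x \<noteq> e}" by auto
    then show ?thesis using True fin by simp
  next
    case False
    then have "{x. poly p x = 0} = {x. poly p x = 0 \<and> x \<noteq> e}" by auto
    then show ?thesis using False by simp
  qed
  ultimately show ?thesis
    using False assms by (simp add: proj_roots_def poly_moebius_0 degree_moebius_less_iff)
qed

section \<open>Transversality and the Wronskian\<close>

lemma is_form_homogeneous:
  assumes "is_form d F"
  shows "F (t * z0) (t * z1) (t * z2) = t ^ d * F z0 z1 z2"
proof -
  obtain c where c: "\<And>z0 z1 z2. F z0 z1 z2 =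
      (\<Sum>i\<le>d. \<Sum>j\<le>d - i. c i j * z0 ^ i * z1 ^ j * z2 ^ (d - i - j))"
    using assms unfolding is_form_def by blast
  have "c i j * (t * z0) ^ i * (t * z1) ^ j * (t * z2) ^ (d - i - j) =
      t ^ d * (c i j * z0 ^ i * z1 ^ j * z2 ^ (d - i - j))" if "i \<le> d" "j \<le> d - i" for i j
  proof -
    have "t ^ d = t ^ i * t ^ j * t ^ (d - i - j)"
      using that by (simp flip: power_add)
    then show ?thesis
      by (simp add: power_mult_distrib)
  qed
  then show ?thesis
    unfolding c sum_distrib_left by (intro sum.cong refl) simp
qed

text \<open>The three functions are chosen before \<open>p\<close>, \<open>q\<close>,
  \<open>r\<close>, so one choice serves all curves. Specialising to coordinate lines then
  identifies them with the partial derivatives, whose existence \<open>deriv\<close> alone does not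
  express.\<close>

lemma is_form_has_total_derivative:
  assumes "is_form d F"
  shows "\<exists>G0 G1 G2. \<forall>p q r p' q' r' t.
    (p has_field_derivative p') (at t) \<longrightarrow> (q has_field_derivative q') (at t) \<longrightarrow>
    (r has_field_derivative r') (at t) \<longrightarrow>
    ((\<lambda>t. F (p t) (q t) (r t)) has_field_derivative
      (G0 (p t) (q t) (r t) * p' + G1 (p t) (q t) (r t) * q' + G2 (p t) (q t) (r t) * r')) (at t)"
proof -
  obtain c where c: "\<And>z0 z1 z2. F z0 z1 z2 =
      (\<Sum>i\<le>d. \<Sum>j\<le>d - i. c i j * z0 ^ i * z1 ^ j * z2 ^ (d - i - j))"
    using assms unfolding is_form_def by blast
  define G0 where "G0 = (\<lambda>z0 z1 z2. \<Sum>i\<le>d. \<Sum>j\<le>d - i.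
    c i j * (of_nat i * z0 ^ (i - 1)) * z1 ^ j * z2 ^ (d - i - j))"
  define G1 where "G1 = (\<lambda>z0 z1 z2. \<Sum>i\<le>d. \<Sum>j\<le>d - i.
    c i j * z0 ^ i * (of_nat j * z1 ^ (j - 1)) * z2 ^ (d - i - j))"
  define G2 where "G2 = (\<lambda>z0 z1 z2. \<Sum>i\<le>d. \<Sum>j\<le>d - i.
    c i j * z0 ^ i * z1 ^ j * (of_nat (d - i - j) * z2 ^ (d - i - j - 1)))"
  have "((\<lambda>t. F (p t) (q t) (r t)) has_field_derivative
      (G0 (p t) (q t) (r t) * p' + G1 (p t) (q t) (r t) * q' + G2 (p t) (q t) (r t) * r')) (at t)"
    if "(p has_field_derivative p') (at t)" "(q has_field_derivative q') (at t)"
      "(r has_field_derivative r') (at t)" for p q r p' q' r' t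
    unfolding c G0_def G1_def G2_def sum_distrib_right sum.distrib[symmetric]
  proof (intro DERIV_sum)
    fix i j
    show "((\<lambda>t. c i j * p t ^ i * q t ^ j * r t ^ (d - i - j)) has_field_derivative
        c i j * (of_nat i * p t ^ (i - 1)) * q t ^ j * r t ^ (d - i - j) * p' +
        c i j * p t ^ i * (of_nat j * q t ^ (j - 1)) * r t ^ (d - i - j) * q' +
        c i j * p t ^ i * q t ^ j * (of_nat (d - i - j) * r t ^ (d - i - j - 1)) * r') (at t)"
      by (rule derivative_eq_intros that refl)+ (simp add: algebra_simps)
  qed
  then show ?thesis by blast
qed

lemma is_form_chain_rule:
  assumes "is_form d F"
    and "(p has_field_derivative p') (at t)" "(q has_field_derivative q') (at t)"
      "(r has_field_derivative r') (at t)"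
  shows "((\<lambda>t. F (p t) (q t) (r t)) has_field_derivative
    (partial0 F (p t) (q t) (r t) * p' + partial1 F (p t) (q t) (r t) * q' +
     partial2 F (p t) (q t) (r t) * r')) (at t)"
proof -
  obtain G0 G1 G2 where G: "\<And>p q r p' q' r' t.
    (p has_field_derivative p') (at t) \<Longrightarrow> (q has_field_derivative q') (at t) \<Longrightarrow>
    (r has_field_derivative r') (at t) \<Longrightarrow>
    ((\<lambda>t. F (p t) (q t) (r t)) has_field_derivative
      (G0 (p t) (q t) (r t) * p' + G1 (p t) (q t) (r t) * q' + G2 (p t) (q t) (r t) * r')) (at t)"
    using is_form_has_total_derivative[OF assms(1)] by blast
  have "partial0 F z0 z1 z2 = G0 z0 z1 z2" for z0 z1 z2
    unfolding partial0_def
    using G[OF DERIV_ident DERIV_const[of z1] DERIV_const[of z2], of z0] DERIV_imp_deriv by auto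
  moreover have "partial1 F z0 z1 z2 = G1 z0 z1 z2" for z0 z1 z2
    unfolding partial1_def
    using G[OF DERIV_const[of z0] DERIV_ident DERIV_const[of z2], of z1] DERIV_imp_deriv by auto
  moreover have "partial2 F z0 z1 z2 = G2 z0 z1 z2" for z0 z1 z2
    unfolding partial2_def
    using G[OF DERIV_const[of z0] DERIV_const[of z1] DERIV_ident, of z2] DERIV_imp_deriv by auto
  ultimately show ?thesis
    using G[OF assms(2-4)] by simp
qed

lemma euler_identity:
  assumes "is_form d F"
  shows "z0 * partial0 F z0 z1 z2 + z1 * partial1 F z0 z1 z2 + z2 * partial2 F z0 z1 z2 =
    of_nat d * F z0 z1 z2"
proof -
  have lin: "((\<lambda>t. t * z) has_field_derivative z) (at t)" for z t :: complex
    by (rule derivative_eq_intros refl | simp)+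
  have "((\<lambda>t. F (t * z0) (t * z1) (t * z2)) has_field_derivative
      (partial0 F z0 z1 z2 * z0 + partial1 F z0 z1 z2 * z1 + partial2 F z0 z1 z2 * z2)) (at 1)"
    using is_form_chain_rule[OF assms lin[of z0] lin[of z1] lin[of z2], of 1] by simp
  moreover have "((\<lambda>t. t ^ d * F z0 z1 z2) has_field_derivative of_nat d * F z0 z1 z2) (at 1)"
    by (rule derivative_eq_intros refl | simp)+
  ultimately show ?thesis
    unfolding is_form_homogeneous[OF assms] using DERIV_unique by (fastforce simp: mult.commute)
qed

section \<open>Zeros of the Wronskian as intersections of the curve with K\<close>

definition wronskian :: "complex poly \<Rightarrow> complex poly \<Rightarrow> complex poly" where
  "wronskian \<phi> f = pderiv \<phi> * f - \<phi> * pderiv f"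

text \<open>For \<open>n > 0\<close> both products have the same coefficient in degree
  \<open>2 * n - 1\<close>, namely \<open>n\<close> times the product of the leading coefficients,
  and these cancel.\<close>

lemma degree_wronskian_le:
  assumes "degree \<phi> = n" "degree f = n"
  shows "degree (wronskian \<phi> f) \<le> 2 * n - 2"
proof (cases "n = 0")
  case True
  then have "pderiv \<phi> = 0" "pderiv f = 0"
    using assms by (auto simp: pderiv_eq_0_iff)
  then show ?thesis
    by (simp add: wronskian_def)
next
  case False
  show ?thesis
  proof (rule degree_le, intro allI impI)
    fix i assume i: "2 * n - 2 < i"
    have deg: "degree (pderiv \<phi>) + degree f = 2 * n - 1" "degree \<phi> + degree (pderiv f) = 2 * n - 1"
      using False assms by (auto simp: degree_pderiv)
    show "coeff (wronskian \<phi> f) i = 0"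
    proof (cases "i = 2 * n - 1")
      case True
      then show ?thesis
        using coeff_mult_degree_sum[of "pderiv \<phi>" f] coeff_mult_degree_sum[of \<phi> "pderiv f"]
          deg assms False
        by (simp add: wronskian_def coeff_pderiv degree_pderiv)
    next
      case False
      then have "degree (pderiv \<phi> * f) < i" "degree (\<phi> * pderiv f) < i"
        using i deg degree_mult_le[of "pderiv \<phi>" f] degree_mult_le[of \<phi> "pderiv f"] by linarith+
      then show ?thesis
        by (simp add: wronskian_def coeff_eq_0)
    qed
  qed
qed

text \<open>On the diagonal the defining identity reads 0 = 0; the value is recovered by
  differentiating it in the first coordinate.\<close>

lemma poncelet_darboux_form_diagonal:
  assumes "poncelet_darboux_form n \<phi> f S"
  shows "S (x * x) (- (x + x)) 1 = poly (wronskian \<phi> f) x"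
proof -
  have S: "is_form (n - 1) S"
    using assms by (simp add: poncelet_darboux_form_def)
  define D where "D = partial0 S (x * x) (- (x + x)) 1 * x + partial1 S (x * x) (- (x + x)) 1 * (- 1) +
    partial2 S (x * x) (- (x + x)) 1 * 0"
  have a: "((\<lambda>r. r * x) has_field_derivative x) (at x)"
    by (rule derivative_eq_intros refl | simp)+
  have b: "((\<lambda>r. - (r + x)) has_field_derivative - 1) (at x)"
    by (rule derivative_eq_intros refl | simp)+
  have "((\<lambda>r. S (r * x) (- (r + x)) 1) has_field_derivative D) (at x)"
    using is_form_chain_rule[OF S a b DERIV_const[of 1]] by (simp add: D_def)
  then have "((\<lambda>r. (r - x) * S (r * x) (- (r + x)) 1) has_field_derivative
      S (x * x) (- (x + x)) 1) (at x)"
    by (auto intro!: derivative_eq_intros)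
  moreover have "((\<lambda>r. poly \<phi> r * poly f x - poly \<phi> x * poly f r) has_field_derivative
      poly (wronskian \<phi> f) x) (at x)"
    by (auto intro!: derivative_eq_intros simp: wronskian_def)
  ultimately show ?thesis
    using assms DERIV_unique unfolding poncelet_darboux_form_def by (metis (no_types, lifting) ext)
qed

lemma partial_conic_K:
  "partial0 conic_K z0 z1 z2 = - 4 * z2" "partial1 conic_K z0 z1 z2 = 2 * z1"
  "partial2 conic_K z0 z1 z2 = - 4 * z0"
  unfolding partial0_def partial1_def partial2_def conic_K_def
  by (rule DERIV_imp_deriv, (rule derivative_eq_intros refl | simp)+)+

text \<open>The gradient of K is \<open>(- 4 * z2, 2 * z1, - 4 * z0)\<close>, so the relation has
  coefficients 4 and \<open>r\<close>. The first is nonzero even for \<open>r = 0\<close>, which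
  covers singular points of the curve.\<close>

lemma transversal_imp_not_proportional:
  assumes "transversal_curves S conic_K" "(z0, z1, z2) \<noteq> (0, 0, 0)"
    "S z0 z1 z2 = 0" "conic_K z0 z1 z2 = 0"
  shows "\<not> (partial0 S z0 z1 z2 = r * z2 \<and> 2 * partial1 S z0 z1 z2 = - r * z1 \<and>
    partial2 S z0 z1 z2 = r * z0)"
proof
  assume r: "partial0 S z0 z1 z2 = r * z2 \<and> 2 * partial1 S z0 z1 z2 = - r * z1 \<and>
    partial2 S z0 z1 z2 = r * z0"
  have "4 * partial1 S z0 z1 z2 + r * (2 * z1) = 2 * (2 * partial1 S z0 z1 z2 + r * z1)"
    by (simp add: algebra_simps)
  also have "\<dots> = 0"
    using r by simp
  finally have "4 * partial0 S z0 z1 z2 + r * partial0 conic_K z0 z1 z2 = 0 \<and>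
      4 * partial1 S z0 z1 z2 + r * partial1 conic_K z0 z1 z2 = 0 \<and>
      4 * partial2 S z0 z1 z2 + r * partial2 conic_K z0 z1 z2 = 0"
    using r by (simp add: partial_conic_K)
  moreover have "(z0, z1, z2) \<in> curve S \<inter> curve conic_K"
    using assms by (simp add: curve_def)
  ultimately have "(4::complex) = 0 \<and> r = 0"
    using assms(1) unfolding transversal_curves_def by fast
  then show False by simp
qed

text \<open>\<open>wronskian \<phi> f\<close> is S along the parametrisation (x^2, -2x, 1) of K. At
  a double zero the gradient of S kills the velocity (2x, -2, 0) and, by Euler's identity, the point
  itself. These vectors span the tangent plane of the cone over K, so the two gradients are
  proportional.\<close>

lemma transversal_imp_wronskian_simple:
  assumes "poncelet_darboux_form n \<phi> f S" "transversal_curves S conic_K"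
    and "poly (wronskian \<phi> f) x = 0"
  shows "poly (pderiv (wronskian \<phi> f)) x \<noteq> 0"
proof
  assume w': "poly (pderiv (wronskian \<phi> f)) x = 0"
  have S: "is_form (n - 1) S"
    using assms by (simp add: poncelet_darboux_form_def)
  let ?p = "\<lambda>P. P S (x * x) (- (x + x)) 1"
  have zero: "S (x * x) (- (x + x)) 1 = 0"
    using assms poncelet_darboux_form_diagonal by simp
  have a: "((\<lambda>r. r * r) has_field_derivative 2 * x) (at x)"
    by (rule derivative_eq_intros refl | simp)+
  have b: "((\<lambda>r. - (r + r)) has_field_derivative - 2) (at x)"
    by (rule derivative_eq_intros refl | simp)+
  have "((\<lambda>r. S (r * r) (- (r + r)) 1) has_field_derivative
      (?p partial0 * (2 * x) + ?p partial1 * (- 2))) (at x)"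
    using is_form_chain_rule[OF S a b DERIV_const[of 1]] by simp
  moreover have "((\<lambda>r. S (r * r) (- (r + r)) 1) has_field_derivative 0) (at x)"
    unfolding poncelet_darboux_form_diagonal[OF assms(1)] using poly_DERIV[where p = "wronskian \<phi> f" and x = x] w'
    by simp
  ultimately have "?p partial0 * (2 * x) + ?p partial1 * (- 2) = 0"
    by (rule DERIV_unique)
  then have p1: "?p partial1 = x * ?p partial0"
    by (simp add: algebra_simps)
  have "x * x * ?p partial0 + - (x + x) * ?p partial1 + 1 * ?p partial2 = 0"
    using euler_identity[OF S, of "x * x" "- (x + x)" 1] zero by simp
  then have p2: "?p partial2 = ?p partial0 * (x * x)"
    unfolding p1 by (simp add: algebra_simps)
  show False
    using transversal_imp_not_proportional[OF assms(2), of "x * x" "- (x + x)" 1 "?p partial0"] zero p1 p2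
    by (simp add: conic_K_def power2_eq_square algebra_simps)
qed

text \<open>The same argument at the point (1, 0, 0) of K, which has parameter infinity, in the
  chart s = -1/x. The Wronskian vanishes there to the order by which its degree falls short of
  \<open>2 * n - 2\<close>.\<close>

lemma transversal_imp_wronskian_simple_at_infinity:
  assumes "poncelet_darboux_form n \<phi> f S" "transversal_curves S conic_K" "degree \<phi> = n" "degree f = n"
    and "n \<ge> 1"
  shows "2 * n - 2 \<le> degree (wronskian \<phi> f) + 1"
proof (rule ccontr)
  define w where "w = wronskian \<phi> f"
  define N where "N = 2 * (n - 1)"
  assume "\<not> 2 * n - 2 \<le> degree (wronskian \<phi> f) + 1"
  then have less: "degree w + 2 \<le> N"
    by (auto simp: w_def N_def)
  have S: "is_form (n - 1) S"
    using assms by (simp add: poncelet_darboux_form_def)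
  define q where "q = moebius_poly N 0 w"
  have "N - degree w = Suc (Suc (N - degree w - 2))"
    using less by simp
  then have "q = monom 1 1 * (monom 1 1 * (monom 1 (N - degree w - 2) * reflect_poly (pcompose w [:0, -1:])))"
    unfolding q_def moebius_poly_def by (simp add: mult_monom flip: mult.assoc)
  then have q: "poly q 0 = 0" "poly (pderiv q) 0 = 0"
    by (auto simp: poly_monom pderiv_mult)
  define g where "g = (\<lambda>s. S 1 (s + s) (s * s))"
  have a: "((\<lambda>r::complex. r + r) has_field_derivative 2) (at x)" for x
    by (rule derivative_eq_intros refl | simp)+
  have b: "((\<lambda>r::complex. r * r) has_field_derivative 2 * x) (at x)" for x
    by (rule derivative_eq_intros refl | simp)+
  have g': "(g has_field_derivative
      (partial1 S 1 (x + x) (x * x) * 2 + partial2 S 1 (x + x) (x * x) * (2 * x))) (at x)" for x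
    using is_form_chain_rule[OF S DERIV_const[of 1] a b] by (simp add: g_def)
  \<comment> \<open>Scaling by \<open>s * s\<close> turns the point of K with parameter
    \<open>- 1 / s\<close> into (1, 2s, s^2).\<close>
  have eq: "g s = poly q s" if "s \<noteq> 0" for s
  proof -
    have "(s * s) * ((- 1 / s) * (- 1 / s)) = 1" "(s * s) * - (- 1 / s + - 1 / s) = s + s"
      using that by (auto simp: field_simps)
    then have "g s = (s * s) ^ (n - 1) * S ((- 1 / s) * (- 1 / s)) (- (- 1 / s + - 1 / s)) 1"
      using is_form_homogeneous[OF S, of "s * s" "(- 1 / s) * (- 1 / s)" "- (- 1 / s + - 1 / s)" 1]
      by (simp only: g_def mult_1_right)
    also have "\<dots> = s ^ N * poly w (- 1 / s)"
      unfolding poncelet_darboux_form_diagonal[OF assms(1)]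
      by (simp add: w_def N_def power_mult power2_eq_square)
    also have "\<dots> = poly q s"
      using less that by (simp add: q_def poly_moebius)
    finally show ?thesis .
  qed
  have "g \<midarrow>0\<rightarrow> g 0"
    using DERIV_isCont[OF g'] isCont_def by blast
  moreover have "g \<midarrow>0\<rightarrow> poly q 0"
    using LIM_equal[of 0 g "poly q" "poly q 0"] eq poly_isCont[where p = q and x = 0] by (simp add: isCont_def)
  ultimately have "g 0 = poly q 0"
    by (rule LIM_unique)
  then have g: "g = poly q"
    using eq by (intro ext) metis
  have S0: "S 1 0 0 = 0"
    using q(1) g by (auto simp: g_def dest: fun_cong[of _ _ 0])
  have "(g has_field_derivative 0) (at 0)"
    unfolding g using poly_DERIV[where p = q and x = 0] q by simp
  then have S1: "partial1 S 1 0 0 = 0"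
    using DERIV_unique[OF g'[of 0], of 0] by simp
  \<comment> \<open>At (1, 0, 0) Euler's identity involves only this partial derivative; the third
    one stays free and serves as the factor \<open>r\<close>.\<close>
  have "partial0 S 1 0 0 = 0"
    using euler_identity[OF S, of 1 0 0] S0 by simp
  then show False
    using transversal_imp_not_proportional[OF assms(2), of 1 0 0 "partial2 S 1 0 0"] S0 S1
    by (simp add: conic_K_def)
qed

lemma transversal_imp_proj_roots_wronskian:
  assumes "poncelet_darboux_form n \<phi> f S" "transversal_curves S conic_K" "degree \<phi> = n" "degree f = n"
    and "n \<ge> 1"
  shows "wronskian \<phi> f \<noteq> 0" "proj_roots (2 * n - 2) (wronskian \<phi> f) = 2 * n - 2"
proof -
  have "rsquarefree (wronskian \<phi> f)"
    using transversal_imp_wronskian_simple[OF assms(1,2)] by (auto simp: rsquarefree_roots)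
  then show "wronskian \<phi> f \<noteq> 0" "proj_roots (2 * n - 2) (wronskian \<phi> f) = 2 * n - 2"
    using transversal_imp_wronskian_simple_at_infinity[OF assms] degree_wronskian_le[OF assms(3,4)]
    by (auto simp: proj_roots_def rsquarefree_card_roots rsquarefree_def)
qed

section \<open>Multiple roots, proportionality and top coefficients of polynomials\<close>

lemma square_dvd_iff_double_root:
  fixes p :: "'a::idom poly"
  shows "[:- c, 1:] ^ 2 dvd p \<longleftrightarrow> poly p c = 0 \<and> poly (pderiv p) c = 0"
proof
  assume "[:- c, 1:] ^ 2 dvd p"
  moreover define X where "X = [:- c, 1:]"
  ultimately obtain k where p: "p = X ^ 2 * k"
    by blast
  have "poly X c = 0"
    by (simp add: X_def)
  then show "poly p c = 0 \<and> poly (pderiv p) c = 0"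
    by (simp add: p power2_eq_square pderiv_mult)
next
  assume *: "poly p c = 0 \<and> poly (pderiv p) c = 0"
  then obtain q where q: "p = [:- c, 1:] * q"
    by (auto simp: poly_eq_0_iff_dvd)
  have "poly q c = 0"
    using * by (simp add: q pderiv_mult pderiv_pCons del: mult_pCons_left mult_pCons_right)
  then obtain r where r: "q = [:- c, 1:] * r"
    by (auto simp: poly_eq_0_iff_dvd)
  have "p = [:- c, 1:] ^ 2 * r"
    unfolding q r power2_eq_square by (rule mult.assoc[symmetric])
  then show "[:- c, 1:] ^ 2 dvd p"
    by (rule dvdI)
qed

lemma cube_dvd_imp_triple_root:
  fixes p :: "'a::idom poly"
  assumes "[:- c, 1:] ^ 3 dvd p"
  shows "poly p c = 0" "poly (pderiv p) c = 0" "poly (pderiv (pderiv p)) c = 0"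
proof -
  define X where "X = [:- c, 1:]"
  obtain k where p: "p = X ^ 3 * k"
    using assms unfolding X_def by blast
  have "poly X c = 0"
    by (simp add: X_def)
  then show "poly p c = 0" "poly (pderiv p) c = 0" "poly (pderiv (pderiv p)) c = 0"
    by (simp_all add: p power3_eq_cube pderiv_mult pderiv_add)
qed

text \<open>Subtracting the multiple of \<open>p\<close> that cancels the coefficient of degree
  \<open>degree p\<close> leaves a polynomial of smaller degree that still has
  \<open>degree p\<close> roots.\<close>

lemma smult_eq_of_roots_subset:
  fixes p q :: "'a::field poly"
  assumes "p \<noteq> 0" "card {x. poly p x = 0} = degree p" "{x. poly p x = 0} \<subseteq> {x. poly q x = 0}"
    and "degree q \<le> degree p"
  shows "\<exists>r. q = smult r p"
proof -
  define h where "h = q - smult (coeff q (degree p) / lead_coeff p) p"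
  have "h = 0"
  proof (rule ccontr)
    assume "h \<noteq> 0"
    have "degree h \<le> degree p"
      using assms(4) degree_smult_le[of "coeff q (degree p) / lead_coeff p" p]
      unfolding h_def by (intro degree_diff_le) auto
    moreover have "coeff h (degree p) = 0"
      using assms(1) by (simp add: h_def)
    ultimately have "degree h < degree p"
      using \<open>h \<noteq> 0\<close> by (metis le_neq_implies_less leading_coeff_0_iff)
    moreover have "card {x. poly p x = 0} \<le> card {x. poly h x = 0}"
      using assms(3) poly_roots_finite[OF \<open>h \<noteq> 0\<close>] by (intro card_mono) (auto simp: h_def)
    ultimately show False
      using card_poly_roots_bound[OF \<open>h \<noteq> 0\<close>] assms(2) by linarith
  qed
  then show ?thesis
    by (auto simp: h_def)
qed

text \<open>Formal degrees \<open>i\<close> and \<open>j\<close> are used because the actual degree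
  of a component drops at parameters where it has a zero at infinity.\<close>

lemma coeff_mult_add_degree_bounds:
  fixes p q :: "'a::comm_semiring_0 poly"
  assumes "degree p \<le> i" "degree q \<le> j"
  shows "coeff (p * q) (i + j) = coeff p i * coeff q j"
proof -
  have "coeff (p * q) (i + j) = (\<Sum>k\<le>i + j. coeff p k * coeff q (i + j - k))"
    by (rule coeff_mult)
  also have "\<dots> = (\<Sum>k\<in>{i}. coeff p k * coeff q (i + j - k))"
  proof (rule sum.mono_neutral_right)
    show "\<forall>k\<in>{..i + j} - {i}. coeff p k * coeff q (i + j - k) = 0"
    proof
      fix k assume "k \<in> {..i + j} - {i}"
      then have "i < k \<or> j < i + j - k" by auto
      then show "coeff p k * coeff q (i + j - k) = 0"
        using assms by (auto simp: coeff_eq_0)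
    qed
  qed auto
  finally show ?thesis by simp
qed

lemma degree_prod_le_sum:
  fixes p :: "'b \<Rightarrow> 'a::comm_semiring_1 poly"
  assumes "\<And>j. j \<in> J \<Longrightarrow> degree (p j) \<le> \<delta> j"
  shows "degree (\<Prod>j\<in>J. p j) \<le> (\<Sum>j\<in>J. \<delta> j)"
  using assms
proof (induction J rule: infinite_finite_induct)
  case (insert j J)
  have "degree (p j) \<le> \<delta> j" "degree (\<Prod>j\<in>J. p j) \<le> (\<Sum>j\<in>J. \<delta> j)"
    using insert.prems by (blast intro: insert.IH)+
  then show ?case
    using insert.hyps degree_mult_le[of "p j" "\<Prod>j\<in>J. p j"] by simp
qed auto

lemma coeff_prod_sum:
  fixes p :: "'b \<Rightarrow> 'a::comm_semiring_1 poly"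
  assumes "finite J" "\<And>j. j \<in> J \<Longrightarrow> degree (p j) \<le> \<delta> j"
  shows "coeff (\<Prod>j\<in>J. p j) (\<Sum>j\<in>J. \<delta> j) = (\<Prod>j\<in>J. coeff (p j) (\<delta> j))"
  using assms
proof (induction J rule: finite_induct)
  case (insert j J)
  have "degree (\<Prod>j\<in>J. p j) \<le> (\<Sum>j\<in>J. \<delta> j)"
    using insert.prems by (intro degree_prod_le_sum) auto
  moreover have "degree (p j) \<le> \<delta> j" "coeff (\<Prod>j\<in>J. p j) (\<Sum>j\<in>J. \<delta> j) = (\<Prod>j\<in>J. coeff (p j) (\<delta> j))"
    using insert by auto
  ultimately show ?case
    using insert coeff_mult_add_degree_bounds[of "p j" "\<delta> j" "\<Prod>j\<in>J. p j" "\<Sum>j\<in>J. \<delta> j"] by simp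
qed auto

section \<open>Pencils of binary forms\<close>

locale coprime_pencil =
  fixes n :: nat and \<phi> f :: "complex poly"
  assumes n: "1 \<le> n" and deg: "degree \<phi> = n" "degree f = n"
    and no_common_zero: "\<nexists>z. poly \<phi> z = 0 \<and> poly f z = 0"
    and wronskian_ne_0: "wronskian \<phi> f \<noteq> 0"
begin

abbreviation "w \<equiv> wronskian \<phi> f"

definition member :: "complex \<Rightarrow> complex \<Rightarrow> complex poly" where
  "member \<alpha> \<beta> = smult \<alpha> f - smult \<beta> \<phi>"

text \<open>The member with zero \<open>a\<close>, scaled so that its value at \<open>y\<close> is
  antisymmetric in \<open>a\<close> and \<open>y\<close>: the right side of the Darboux identity at
  \<open>(a, y)\<close>.\<close>

definition through :: "complex \<Rightarrow> complex poly" where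
  "through a = member (poly \<phi> a) (poly f a)"

lemma poly_through: "poly (through a) y = poly \<phi> a * poly f y - poly f a * poly \<phi> y"
  by (simp add: through_def member_def)

lemma through_sym: "poly (through a) y = - poly (through y) a"
  by (simp add: poly_through)

lemma poly_pderiv_through_self: "poly (pderiv (through a)) a = - poly w a"
  by (simp add: through_def member_def wronskian_def pderiv_diff pderiv_smult)

lemma poly_pderiv2_through_self: "poly (pderiv (pderiv (through a))) a = - poly (pderiv w) a"
  by (simp add: through_def member_def wronskian_def pderiv_diff pderiv_smult pderiv_mult)

text \<open>Without common zeros, vanishing at \<open>c\<close> is a nontrivial linear condition on
  the two parameters, so its solutions form a line.\<close>

lemma member_proportional:
  assumes "poly (member \<alpha> \<beta>) c = 0" "(\<alpha>, \<beta>) \<noteq> (0, 0)"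
  shows "\<exists>r. r \<noteq> 0 \<and> member \<alpha> \<beta> = smult r (through c)"
proof -
  have eq: "\<alpha> * poly f c = \<beta> * poly \<phi> c"
    using assms by (simp add: member_def)
  have ne: "poly \<phi> c \<noteq> 0 \<or> poly f c \<noteq> 0"
    using no_common_zero by blast
  obtain r where "\<alpha> = r * poly \<phi> c" "\<beta> = r * poly f c"
  proof (cases "poly \<phi> c = 0")
    case True
    with ne eq show ?thesis
      by (intro that[of "\<beta> / poly f c"]) auto
  next
    case False
    with eq show ?thesis
      by (intro that[of "\<alpha> / poly \<phi> c"]) (auto simp: field_simps)
  qed
  then show ?thesis
    using assms(2) by (intro exI[of _ r]) (auto simp: member_def through_def smult_diff_right)
qed

lemma through_proportional:
  assumes "poly (through a) c = 0"
  shows "\<exists>r. r \<noteq> 0 \<and> through a = smult r (through c)"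
  using assms no_common_zero unfolding through_def[of a] by (intro member_proportional) auto

text \<open>A zero member is a linear dependence between \<open>\<phi>\<close> and \<open>f\<close>,
  and this would make the Wronskian vanish identically.\<close>

lemma member_ne_0:
  assumes "(\<alpha>, \<beta>) \<noteq> (0, 0)"
  shows "member \<alpha> \<beta> \<noteq> 0"
proof
  assume "member \<alpha> \<beta> = 0"
  then have eq: "smult \<alpha> f = smult \<beta> \<phi>"
    by (simp add: member_def)
  have "smult \<alpha> w = pderiv \<phi> * smult \<alpha> f - \<phi> * pderiv (smult \<alpha> f)"
    by (simp add: wronskian_def smult_diff_right pderiv_smult)
  also have "\<dots> = 0"
    unfolding eq by (simp add: pderiv_smult mult.commute)
  finally have "\<alpha> = 0"
    using wronskian_ne_0 by simp
  moreover have "smult \<beta> w = pderiv (smult \<beta> \<phi>) * f - smult \<beta> \<phi> * pderiv f"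
    by (simp add: wronskian_def smult_diff_right pderiv_smult)
  then have "smult \<beta> w = 0"
    unfolding eq[symmetric] by (simp add: pderiv_smult mult.commute)
  then have "\<beta> = 0"
    using wronskian_ne_0 by simp
  ultimately show False
    using assms by simp
qed

lemma through_ne_0: "through a \<noteq> 0"
  using no_common_zero unfolding through_def by (intro member_ne_0) auto

lemma degree_member_le: "degree (member \<alpha> \<beta>) \<le> n"
  using degree_smult_le[of \<alpha> f] degree_smult_le[of \<beta> \<phi>] deg
  unfolding member_def by (intro degree_diff_le) auto

text \<open>The member of the pencil with the zero \<open>\<infinity>\<close>, since its coefficient of degree \<open>n\<close> vanishes.\<close>

definition through_infinity :: "complex poly" where
  "through_infinity = member (coeff \<phi> n) (coeff f n)"

lemma lead_coeff_ne_0: "coeff \<phi> n \<noteq> 0" "coeff f n \<noteq> 0"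
  using deg n by (metis degree_0 leading_coeff_0_iff not_one_le_zero)+

lemma through_infinity_ne_0: "through_infinity \<noteq> 0"
  using lead_coeff_ne_0 unfolding through_infinity_def by (intro member_ne_0) auto

lemma coeff_through_degree: "coeff (through a) n = - poly through_infinity a"
  by (simp add: through_def through_infinity_def member_def)

text \<open>Up to a nonzero factor, the first two derivatives of the member at its root
  \<open>c\<close> are the values of \<open>w\<close> and \<open>pderiv w\<close> there, and
  \<open>w\<close> has no double root.\<close>

lemma order_member_root:
  assumes "poly (member \<alpha> \<beta>) c = 0" "(\<alpha>, \<beta>) \<noteq> (0, 0)" "rsquarefree w"
  shows "order c (member \<alpha> \<beta>) = (if poly w c = 0 then 2 else 1)"
proof -
  obtain r where r: "r \<noteq> 0" "member \<alpha> \<beta> = smult r (through c)"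
    using member_proportional[OF assms(1,2)] by blast
  have ne: "member \<alpha> \<beta> \<noteq> 0"
    using assms by (intro member_ne_0)
  have le: "k \<le> order c (member \<alpha> \<beta>) \<longleftrightarrow> [:- c, 1:] ^ k dvd member \<alpha> \<beta>" for k
    using ne by (simp add: order_divides)
  have 1: "1 \<le> order c (member \<alpha> \<beta>)"
    using assms(1) ne by (simp add: order_root Suc_leI)
  have 2: "2 \<le> order c (member \<alpha> \<beta>) \<longleftrightarrow> poly w c = 0"
    unfolding le square_dvd_iff_double_root using assms(1) r
    by (simp add: pderiv_smult poly_pderiv_through_self)
  have 3: "\<not> 3 \<le> order c (member \<alpha> \<beta>)"
  proof
    assume "3 \<le> order c (member \<alpha> \<beta>)"
    then have "poly (pderiv (member \<alpha> \<beta>)) c = 0" "poly (pderiv (pderiv (member \<alpha> \<beta>))) c = 0"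
      unfolding le by (blast dest: cube_dvd_imp_triple_root)+
    then have "poly w c = 0" "poly (pderiv w) c = 0"
      using r by (auto simp: pderiv_smult poly_pderiv_through_self poly_pderiv2_through_self)
    then show False
      using assms(3) by (auto simp: rsquarefree_roots)
  qed
  show ?thesis
    using 1 2 3 by auto
qed

text \<open>The degree drops only if \<open>a\<close> lies in the fibre of infinity, and a multiple
  root appears only if \<open>a\<close> lies in the fibre of a zero of \<open>w\<close>: finitely
  many fibres.\<close>

lemma finite_nongeneric:
  assumes "rsquarefree w"
  shows "finite {a. \<not> (degree (through a) = n \<and> card {y. poly (through a) y = 0} = n)}"
proof (rule finite_subset)
  show "{a. \<not> (degree (through a) = n \<and> card {y. poly (through a) y = 0} = n)} \<subseteq>
      {a. poly through_infinity a = 0} \<union> (\<Union>c\<in>{c. poly w c = 0}. {a. poly (through c) a = 0})"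
  proof (rule subsetI, rule ccontr)
    fix a
    assume a: "a \<in> {a. \<not> (degree (through a) = n \<and> card {y. poly (through a) y = 0} = n)}"
      and "a \<notin> {a. poly through_infinity a = 0} \<union>
        (\<Union>c\<in>{c. poly w c = 0}. {a. poly (through c) a = 0})"
    then have inf: "poly through_infinity a \<noteq> 0"
      and w: "\<And>c. poly w c = 0 \<Longrightarrow> poly (through c) a \<noteq> 0"
      by auto
    have "degree (through a) = n"
      using degree_member_le le_degree[of "through a" n] inf coeff_through_degree[of a]
      unfolding through_def by (metis antisym neg_equal_0_iff_equal)
    moreover have "rsquarefree (through a)"
      unfolding rsquarefree_roots
    proof (intro allI notI, elim conjE)
      fix y assume y: "poly (through a) y = 0" "poly (pderiv (through a)) y = 0"
      obtain r where "r \<noteq> 0" "through a = smult r (through y)"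
        using through_proportional[OF y(1)] by blast
      with y(2) have "poly w y = 0"
        by (simp add: pderiv_smult poly_pderiv_through_self)
      with w[of y] y(1) show False
        using through_sym[of a y] by simp
    qed
    ultimately show False
      using a rsquarefree_card_roots by auto
  qed
  show "finite ({a. poly through_infinity a = 0} \<union>
      (\<Union>c\<in>{c. poly w c = 0}. {a. poly (through c) a = 0}))"
    using through_infinity_ne_0 wronskian_ne_0 through_ne_0 by (auto intro: poly_roots_finite)
qed

text \<open>The equation of the curve on the tangent line with parameter \<open>a\<close>. The sign
  makes \<open>a - y\<close> the removed factor, so that the result is symmetric in \<open>a\<close>
  and \<open>y\<close>.\<close>

definition quot :: "complex \<Rightarrow> complex poly" where
  "quot a = - (through a div [:- a, 1:])"

lemma through_eq_quot: "through a = [:a, - 1:] * quot a"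
proof -
  have "[:- a, 1:] dvd through a"
    by (simp add: poly_eq_0_iff_dvd[symmetric] poly_through)
  then have "through a = [:- a, 1:] * (through a div [:- a, 1:])"
    by (rule dvd_mult_div_cancel[symmetric])
  also have "\<dots> = [:a, - 1:] * quot a"
    by (simp add: quot_def)
  finally show ?thesis .
qed

lemma poly_through_eq_quot: "poly (through a) y = (a - y) * poly (quot a) y"
  by (subst through_eq_quot) (simp add: algebra_simps)

lemma poly_pderiv_through: "poly (pderiv (through a)) y = (a - y) * poly (pderiv (quot a)) y - poly (quot a) y"
  by (subst through_eq_quot) (simp add: pderiv_mult pderiv_pCons algebra_simps del: mult_pCons_left mult_pCons_right)

lemma quot_sym: "poly (quot a) y = poly (quot y) a"
proof (cases "a = y")
  case False
  have "(a - y) * poly (quot a) y = (a - y) * poly (quot y) a"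
    using through_sym[of a y] unfolding poly_through_eq_quot by (simp add: algebra_simps)
  then show ?thesis
    using False by simp
qed simp

lemma poly_quot_self: "poly (quot a) a = poly w a"
  using poly_pderiv_through[of a a] poly_pderiv_through_self[of a] by simp

lemma quot_ne_0: "quot a \<noteq> 0"
  using through_ne_0[of a] through_eq_quot[of a] by auto

lemma quot_dvd_through: "quot a dvd through a"
  by (metis dvd_triv_right through_eq_quot)

lemma degree_through_quot: "degree (through a) = Suc (degree (quot a))"
  using quot_ne_0[of a] by (subst through_eq_quot) (simp add: degree_mult_eq del: mult_pCons_left mult_pCons_right)

lemma degree_quot_le: "degree (quot a) \<le> n - 1"
  using degree_member_le[of "poly \<phi> a" "poly f a"] degree_through_quot[of a]
  by (simp add: through_def)

text \<open>The coefficient of formal top degree is the value at \<open>y\<close> =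
  infinity.\<close>

lemma coeff_quot_degree: "coeff (quot a) (n - 1) = poly through_infinity a"
proof -
  obtain m where m: "n = Suc m"
    using n by (cases n) auto
  have "coeff (through a) n = a * coeff (quot a) n - coeff (quot a) (n - 1)"
    by (subst through_eq_quot) (simp add: m)
  moreover have "coeff (quot a) n = 0"
    using degree_quot_le[of a] n by (intro coeff_eq_0) linarith
  ultimately show ?thesis
    using coeff_through_degree[of a] by simp
qed

end

section \<open>Symmetric biquadratic polynomials\<close>

text \<open>The symmetric polynomial \<open>a x\<^sup>2y\<^sup>2 + b xy(x + y) + c (x\<^sup>2 + y\<^sup>2) + d xy + e (x + y) + g\<close> as a
  polynomial in \<open>y\<close>: a conic in Darboux coordinates, or a line if \<open>a = b = c = 0\<close>. Since it is
  symmetric, \<open>pderiv (biquad a b c d e g y)\<close> at \<open>x\<close> is its partial derivative by \<open>x\<close> at \<open>(x, y)\<close>.\<close>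

definition biquad :: "complex \<Rightarrow> complex \<Rightarrow> complex \<Rightarrow> complex \<Rightarrow> complex \<Rightarrow> complex \<Rightarrow> complex \<Rightarrow> complex poly"
  where "biquad a b c d e g x = [:poly [:g, e, c:] x, poly [:e, d, b:] x, poly [:c, b, a:] x:]"

text \<open>The discriminant with respect to \<open>y\<close>. As a quartic in \<open>x\<close> it
  describes the four common tangents of the conic and K.\<close>

definition biquad_disc :: "complex \<Rightarrow> complex \<Rightarrow> complex \<Rightarrow> complex \<Rightarrow> complex \<Rightarrow> complex \<Rightarrow> complex poly"
  where "biquad_disc a b c d e g = [:e, d, b:] ^ 2 - smult 4 ([:c, b, a:] * [:g, e, c:])"

definition biquad_diag :: "complex \<Rightarrow> complex \<Rightarrow> complex \<Rightarrow> complex \<Rightarrow> complex \<Rightarrow> complex \<Rightarrow> complex poly"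
  where "biquad_diag a b c d e g = [:g, 2 * e, 2 * c + d, 2 * b, a:]"

lemma biquad_sym: "poly (biquad a b c d e g x) y = poly (biquad a b c d e g y) x"
  by (simp add: biquad_def algebra_simps)

lemma poly_pderiv_biquad:
  "poly (pderiv (biquad a b c d e g x)) y = poly [:e, d, b:] x + 2 * poly [:c, b, a:] x * y"
  by (simp add: biquad_def pderiv_pCons algebra_simps)

lemma poly_biquad_diag: "poly (biquad_diag a b c d e g) x = poly (biquad a b c d e g x) x"
  by (simp add: biquad_def biquad_diag_def algebra_simps)

lemma poly_pderiv_biquad_diag:
  "poly (pderiv (biquad_diag a b c d e g)) x = 2 * poly (pderiv (biquad a b c d e g x)) x"
  by (simp add: poly_pderiv_biquad biquad_diag_def pderiv_pCons algebra_simps)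

lemma poly_biquad_disc: "poly (biquad_disc a b c d e g) x =
    poly [:e, d, b:] x ^ 2 - 4 * (poly [:c, b, a:] x * poly [:g, e, c:] x)"
  unfolding biquad_disc_def by (simp only: poly_diff poly_power poly_smult poly_mult)

lemma degree_biquad_disc_le: "degree (biquad_disc a b c d e g) \<le> 4"
  unfolding biquad_disc_def power2_eq_square by (simp add: degree_pCons_le)

lemma coeff_biquad_disc_4: "coeff (biquad_disc a b c d e g) 4 = b ^ 2 - 4 * a * c"
  unfolding biquad_disc_def by (simp add: power2_eq_square numeral_eq_Suc)

lemma biquad_disc_eq_0:
  assumes "poly (biquad_disc a b c d e g) x = 0" "poly [:c, b, a:] x \<noteq> 0"
  defines "y \<equiv> - poly [:e, d, b:] x / (2 * poly [:c, b, a:] x)"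
  shows "poly [:e, d, b:] x = - 2 * poly [:c, b, a:] x * y"
    "poly [:g, e, c:] x = poly [:c, b, a:] x * y ^ 2"
proof -
  define A B D where "A = poly [:c, b, a:] x" and "B = poly [:e, d, b:] x" and "D = poly [:g, e, c:] x"
  have *: "A \<noteq> 0" "B ^ 2 = 4 * A * D" "y = - B / (2 * A)"
    using assms unfolding A_def B_def D_def poly_biquad_disc by simp_all
  then have B: "B = - 2 * A * y"
    by simp
  then have "4 * A * (A * y ^ 2) = 4 * A * D"
    using *(2) by (simp add: power2_eq_square algebra_simps)
  then have "D = A * y ^ 2"
    using *(1) by simp
  with B show "poly [:e, d, b:] x = - 2 * poly [:c, b, a:] x * y"
    "poly [:g, e, c:] x = poly [:c, b, a:] x * y ^ 2"
    unfolding A_def B_def D_def .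
qed

lemma biquad_disc_double_root:
  assumes "poly (biquad_disc a b c d e g) x = 0" "poly [:c, b, a:] x \<noteq> 0"
  defines "y \<equiv> - poly [:e, d, b:] x / (2 * poly [:c, b, a:] x)"
  shows "poly (biquad a b c d e g x) y = 0" "poly (pderiv (biquad a b c d e g x)) y = 0"
proof -
  note * = biquad_disc_eq_0[OF assms(1,2), folded y_def]
  define A where "A = poly [:c, b, a:] x"
  show "poly (pderiv (biquad a b c d e g x)) y = 0"
    unfolding poly_pderiv_biquad *(1) by (simp add: algebra_simps)
  have "poly (biquad a b c d e g x) y =
      poly [:g, e, c:] x + y * poly [:e, d, b:] x + y ^ 2 * poly [:c, b, a:] x"
    by (simp add: biquad_def power2_eq_square algebra_simps)
  also have "\<dots> = A * y ^ 2 + y * (- 2 * A * y) + y ^ 2 * A"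
    unfolding * A_def ..
  also have "\<dots> = 0"
    by (simp add: power2_eq_square)
  finally show "poly (biquad a b c d e g x) y = 0" .
qed

lemma biquad_double_root_imp_disc:
  assumes "biquad a b c d e g x \<noteq> 0"
    and "poly (biquad a b c d e g x) y = 0" "poly (pderiv (biquad a b c d e g x)) y = 0"
  shows "poly [:c, b, a:] x \<noteq> 0" "poly (biquad_disc a b c d e g) x = 0"
    "y = - poly [:e, d, b:] x / (2 * poly [:c, b, a:] x)"
proof -
  define A B D where "A = poly [:c, b, a:] x" and "B = poly [:e, d, b:] x" and "D = poly [:g, e, c:] x"
  have eq: "D + y * B + y ^ 2 * A = 0" "B + 2 * A * y = 0"
    using assms(2,3) unfolding poly_pderiv_biquad
    by (auto simp: A_def B_def D_def biquad_def power2_eq_square algebra_simps)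
  have "A \<noteq> 0"
  proof
    assume "A = 0"
    with eq have "B = 0" "D = 0" by auto
    with \<open>A = 0\<close> assms(1) show False
      by (simp add: A_def B_def D_def biquad_def)
  qed
  then show "poly [:c, b, a:] x \<noteq> 0"
    by (simp add: A_def)
  have B: "B = - 2 * A * y"
    using eq(2) by (simp add: algebra_simps eq_neg_iff_add_eq_0)
  then show "y = - poly [:e, d, b:] x / (2 * poly [:c, b, a:] x)"
    using \<open>A \<noteq> 0\<close> unfolding A_def[symmetric] B_def[symmetric] by simp
  have "D = A * y ^ 2"
    using eq(1) unfolding B by (simp add: power2_eq_square algebra_simps)
  then have "B ^ 2 - 4 * (A * D) = 0"
    unfolding B by (simp add: power2_eq_square)
  then show "poly (biquad_disc a b c d e g) x = 0"
    unfolding poly_biquad_disc A_def B_def D_def .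
qed

text \<open>Write the discriminant as B^2 - 4AD. At its root, B = -2Ay and D = Ay^2 turn the
  derivative into -4A(D' + yB' + y^2 A'), and the bracket is the partial derivative of the conic by
  \<open>x\<close>. Hence a multiple root would be a singular point of the conic.\<close>

lemma poly_pderiv_biquad_disc:
  assumes "poly (biquad_disc a b c d e g) x = 0" "poly [:c, b, a:] x \<noteq> 0"
  defines "y \<equiv> - poly [:e, d, b:] x / (2 * poly [:c, b, a:] x)"
  shows "poly (pderiv (biquad_disc a b c d e g)) x =
    - 4 * poly [:c, b, a:] x * poly (pderiv (biquad a b c d e g y)) x"
proof -
  note * = biquad_disc_eq_0[OF assms(1,2), folded y_def]
  define A where "A = poly [:c, b, a:] x"
  have "poly (pderiv (biquad_disc a b c d e g)) x =
      2 * poly [:e, d, b:] x * (d + 2 * b * x)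
      - 4 * (poly [:c, b, a:] x * (e + 2 * c * x) + (b + 2 * a * x) * poly [:g, e, c:] x)"
    unfolding biquad_disc_def power2_eq_square pderiv_diff pderiv_smult pderiv_mult
    by (simp add: pderiv_pCons algebra_simps del: mult_pCons_left mult_pCons_right)
  also have "\<dots> = - 4 * A * ((e + 2 * c * x) + y * (d + 2 * b * x) + y ^ 2 * (b + 2 * a * x))"
    unfolding * A_def[symmetric] by (simp add: algebra_simps)
  also have "(e + 2 * c * x) + y * (d + 2 * b * x) + y ^ 2 * (b + 2 * a * x) =
      poly (pderiv (biquad a b c d e g y)) x"
    unfolding poly_pderiv_biquad by (simp add: power2_eq_square algebra_simps)
  finally show ?thesis
    by (simp add: A_def)
qed

lemma finite_biquad_eq_0:
  assumes "\<not> (a = 0 \<and> b = 0 \<and> c = 0 \<and> d = 0 \<and> e = 0 \<and> g = 0)"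
  shows "finite {x. biquad a b c d e g x = 0}"
proof (rule finite_subset)
  show "{x. biquad a b c d e g x = 0} \<subseteq>
      {x. poly [:g, e, c:] x = 0} \<inter> {x. poly [:e, d, b:] x = 0} \<inter> {x. poly [:c, b, a:] x = 0}"
    by (auto simp: biquad_def)
  have "[:g, e, c:] \<noteq> 0 \<or> [:e, d, b:] \<noteq> 0 \<or> [:c, b, a:] \<noteq> 0"
    using assms by auto
  then have "finite {x. poly [:g, e, c:] x = 0} \<or> finite {x. poly [:e, d, b:] x = 0} \<or>
      finite {x. poly [:c, b, a:] x = 0}"
    using poly_roots_finite by blast
  then show "finite ({x. poly [:g, e, c:] x = 0} \<inter> {x. poly [:e, d, b:] x = 0} \<inter>
      {x. poly [:c, b, a:] x = 0})"
    by (elim disjE) (blast intro: finite_Int)+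
qed

lemma quadratic_two_roots_imp_disc:
  assumes "card {x::complex. poly [:c, b, a:] x = 0} \<ge> 2" "[:c, b, a:] \<noteq> 0"
  shows "b ^ 2 - 4 * a * c \<noteq> 0"
proof
  assume disc: "b ^ 2 - 4 * a * c = 0"
  have "{x. poly [:c, b, a:] x = 0} \<subseteq> {- b / (2 * a)}"
  proof
    fix x assume x: "x \<in> {x. poly [:c, b, a:] x = 0}"
    have "(2 * a * x + b) ^ 2 = 4 * a * poly [:c, b, a:] x + (b ^ 2 - 4 * a * c)"
      by (simp add: power2_eq_square algebra_simps)
    then have "2 * a * x + b = 0"
      using x disc by simp
    moreover have "a \<noteq> 0"
    proof
      assume "a = 0"
      then have "b = 0" using disc by simp
      then show False
        using x \<open>a = 0\<close> assms(2) by simp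
    qed
    moreover from calculation have "x * (2 * a) = - b"
      by (simp add: eq_neg_iff_add_eq_0 mult.commute)
    ultimately show "x \<in> {- b / (2 * a)}"
      using eq_divide_imp[of "2 * a" x "- b"] by simp
  qed
  then have "card {x. poly [:c, b, a:] x = 0} \<le> card {- b / (2 * a)}"
    by (intro card_mono) auto
  with assms(1) show False
    by simp
qed

section \<open>Completely decomposed Poncelet-Darboux curves\<close>

text \<open>The curve has \<open>m\<close> conics \<open>j < m\<close> and \<open>l \<le> 1\<close> lines; the factor \<open>j = m\<close> is the line, or a
  nonzero constant if \<open>l = 0\<close>. The coordinate \<open>\<infinity>\<close> is assumed to be generic. As \<open>through x\<close> is
  \<open>x - y\<close> times the equation of the curve, the last assumption says that the components cover the
  curve.\<close>

locale decomposed_pencil = coprime_pencil +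
  fixes m l :: nat and a b c d e g :: "nat \<Rightarrow> complex"
  assumes wronskian_squarefree: "rsquarefree w" and degree_wronskian: "degree w = 2 * n - 2"
    and card_through_infinity: "card {x. poly through_infinity x = 0} = n - 1"
    and count: "n - 1 = 2 * m + l" "l \<le> 1"
    and line: "a m = 0" "b m = 0" "c m = 0" "l = 0 \<Longrightarrow> d m = 0 \<and> e m = 0"
    and nonzero: "j \<le> m \<Longrightarrow>
      \<not> (a j = 0 \<and> b j = 0 \<and> c j = 0 \<and> d j = 0 \<and> e j = 0 \<and> g j = 0)"
    and nonsingular: "j < m \<Longrightarrow> x \<noteq> y \<Longrightarrow>
      poly (biquad (a j) (b j) (c j) (d j) (e j) (g j) x) y = 0 \<Longrightarrow>
      poly (pderiv (biquad (a j) (b j) (c j) (d j) (e j) (g j) x)) y = 0 \<Longrightarrow>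
      poly (pderiv (biquad (a j) (b j) (c j) (d j) (e j) (g j) y)) x \<noteq> 0"
    and cover: "x \<noteq> 0 \<Longrightarrow> y \<noteq> 0 \<Longrightarrow> x \<noteq> y \<Longrightarrow> poly (through x) y = 0 \<Longrightarrow>
      \<exists>j\<le>m. poly (biquad (a j) (b j) (c j) (d j) (e j) (g j) x) y = 0"
begin

definition comp :: "nat \<Rightarrow> complex \<Rightarrow> complex poly" where
  "comp j = biquad (a j) (b j) (c j) (d j) (e j) (g j)"

definition comp_deg :: "nat \<Rightarrow> nat" where
  "comp_deg j = (if j < m then 2 else l)"

definition comps :: "complex \<Rightarrow> complex poly" where
  "comps x = (\<Prod>j\<le>m. comp j x)"

definition cofactor :: "nat \<Rightarrow> complex \<Rightarrow> complex poly" where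
  "cofactor j x = (\<Prod>k\<in>{..m} - {j}. comp k x)"

lemma comp_sym: "poly (comp j x) y = poly (comp j y) x"
  unfolding comp_def by (rule biquad_sym)

lemma comps_sym: "poly (comps x) y = poly (comps y) x"
  unfolding comps_def poly_prod by (intro prod.cong refl comp_sym)

lemma cofactor_sym: "poly (cofactor j x) y = poly (cofactor j y) x"
  unfolding cofactor_def poly_prod by (intro prod.cong refl comp_sym)

lemma comps_eq: "j \<le> m \<Longrightarrow> comps x = comp j x * cofactor j x"
  unfolding comps_def cofactor_def by (subst prod.remove[of _ j]) auto

lemma degree_comp_le:
  assumes "j \<le> m"
  shows "degree (comp j x) \<le> comp_deg j"
proof -
  consider "j < m" | "j = m" "l = 0" | "j = m" "l = 1"
    using assms count(2) by fastforce
  then show ?thesis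
    unfolding comp_deg_def using line by cases (simp_all add: comp_def biquad_def degree_pCons_le)
qed

lemma sum_comp_deg: "(\<Sum>j\<le>m. comp_deg j) = n - 1"
proof -
  have "(\<Sum>j\<le>m. comp_deg j) = (\<Sum>j<m. comp_deg j) + comp_deg m"
    by (simp flip: lessThan_Suc_atMost)
  also have "(\<Sum>j<m. comp_deg j) = (\<Sum>j<m. 2)"
    by (intro sum.cong) (auto simp: comp_deg_def)
  finally show ?thesis
    using count by (simp add: comp_deg_def)
qed

lemma degree_comps_le: "degree (comps x) \<le> n - 1"
  using degree_prod_le_sum[of "{..m}" "\<lambda>j. comp j x" comp_deg] degree_comp_le sum_comp_deg
  unfolding comps_def by simp

lemma comps_ne_0: "\<exists>x. comps x \<noteq> 0"
proof -
  have "finite (\<Union>j\<in>{..m}. {x. comp j x = 0})"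
    using nonzero finite_biquad_eq_0 unfolding comp_def by blast
  then obtain x where "x \<notin> (\<Union>j\<in>{..m}. {x. comp j x = 0})"
    using ex_new_if_finite[OF infinite_UNIV_char_0[where 'a = complex]] by blast
  then have "comps x \<noteq> 0"
    by (auto simp: comps_def)
  then show ?thesis ..
qed

lemma comps_proportional_quot: "\<exists>r. r \<noteq> 0 \<and> (\<forall>x. comps x = smult r (quot x))"
proof -
  \<comment> \<open>Besides the nongeneric tangent lines, those touching K at a point of the curve
    are excluded, so that \<open>quot x\<close> does not vanish at \<open>x\<close>, and so are 0
    and its fibre, since \<open>cover\<close> speaks only of nonzero coordinates.\<close>
  define B where "B = {x. \<not> (degree (through x) = n \<and> card {y. poly (through x) y = 0} = n)} \<union>
    {x. poly w x = 0} \<union> {x. poly (through 0) x = 0} \<union> {0}"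
  have finB: "finite B"
    unfolding B_def using finite_nongeneric[OF wronskian_squarefree] wronskian_ne_0 through_ne_0
    by (simp add: poly_roots_finite)
  have "\<exists>r. comps x = smult r (quot x)" if x: "x \<notin> B" for x
  proof (rule smult_eq_of_roots_subset)
    have gen: "degree (through x) = n" "card {y. poly (through x) y = 0} = n" "poly w x \<noteq> 0"
      "poly (through 0) x \<noteq> 0" "x \<noteq> 0"
      using x by (auto simp: B_def)
    show "quot x \<noteq> 0"
      by (rule quot_ne_0)
    have deg: "degree (quot x) = n - 1"
      using gen(1) degree_through_quot[of x] by simp
    have "{y. poly (through x) y = 0} = insert x {y. poly (quot x) y = 0}"
      by (auto simp: poly_through_eq_quot)
    moreover have "poly (quot x) x \<noteq> 0"
      using gen(3) by (simp add: poly_quot_self)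
    ultimately show "card {y. poly (quot x) y = 0} = degree (quot x)"
      using gen(2) deg poly_roots_finite[OF quot_ne_0] by simp
    show "degree (comps x) \<le> degree (quot x)"
      unfolding deg by (rule degree_comps_le)
    show "{y. poly (quot x) y = 0} \<subseteq> {y. poly (comps x) y = 0}"
    proof
      fix y assume "y \<in> {y. poly (quot x) y = 0}"
      then have y: "poly (quot x) y = 0" "poly (through x) y = 0"
        by (auto simp: poly_through_eq_quot)
      have "y \<noteq> x"
        using y gen(3) poly_quot_self[of x] by auto
      moreover have "y \<noteq> 0"
        using y gen(4) through_sym[of x 0] by auto
      ultimately obtain j where "j \<le> m" "poly (comp j x) y = 0"
        using cover[of x y] gen(5) y by (auto simp: comp_def)
      then show "y \<in> {y. poly (comps x) y = 0}"
        by (auto simp: comps_def poly_prod)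
    qed
  qed
  then obtain r where r: "\<And>x. x \<notin> B \<Longrightarrow> comps x = smult (r x) (quot x)"
    by metis
  obtain x0 where x0: "x0 \<notin> B"
    using ex_new_if_finite[OF infinite_UNIV_char_0[where 'a = complex] finB] by blast
  define B' where "B' = B \<union> {y. poly (quot x0) y = 0}"
  have finB': "finite B'"
    unfolding B'_def using finB quot_ne_0 by (simp add: poly_roots_finite)
  \<comment> \<open>Both products are symmetric, so the value at the pair \<open>x0\<close>,
    \<open>y\<close> can be read on either tangent line.\<close>
  have "r y = r x0" if "y \<notin> B'" for y
  proof -
    have "r y * poly (quot x0) y = r x0 * poly (quot x0) y"
      using comps_sym[of x0 y] r[OF x0] r[of y] that quot_sym[of x0 y] by (simp add: B'_def)
    then show ?thesis
      using that by (simp add: B'_def)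
  qed
  then have r': "comps y = smult (r x0) (quot y)" if "y \<notin> B'" for y
    using r[of y] that by (simp add: B'_def)
  \<comment> \<open>For arbitrary \<open>x\<close> both sides are polynomials in \<open>y\<close>,
    and by symmetry they agree for all \<open>y\<close> outside the finite set
    \<open>B'\<close>.\<close>
  have all: "comps x = smult (r x0) (quot x)" for x
  proof (rule ccontr)
    assume "comps x \<noteq> smult (r x0) (quot x)"
    then have "finite {y. poly (comps x - smult (r x0) (quot x)) y = 0}"
      by (intro poly_roots_finite) simp
    moreover have "- B' \<subseteq> {y. poly (comps x - smult (r x0) (quot x)) y = 0}"
      using r' comps_sym[of x] quot_sym[of x] by auto
    ultimately have "finite (- B')"
      by (rule rev_finite_subset)
    then show False
      using finB' infinite_UNIV_char_0[where 'a = complex] by simp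
  qed
  moreover have "r x0 \<noteq> 0"
    using comps_ne_0 all by auto
  ultimately show ?thesis by blast
qed

lemma comps_nonzero: "comps x \<noteq> 0"
  using comps_proportional_quot quot_ne_0 by (metis smult_eq_0_iff)

lemma comp_nonzero: "j \<le> m \<Longrightarrow> comp j x \<noteq> 0"
  using comps_nonzero[of x] comps_eq[of j x] by auto

lemma dvd_comps_imp_dvd_through:
  assumes "p dvd comps x"
  shows "p dvd through x"
proof -
  obtain r where "r \<noteq> 0" "comps x = smult r (quot x)"
    using comps_proportional_quot by blast
  then show ?thesis
    using assms dvd_trans[OF _ quot_dvd_through] by (simp add: dvd_smult_iff)
qed

lemma poly_comps_eq_0_iff: "x \<noteq> y \<Longrightarrow> poly (comps x) y = 0 \<longleftrightarrow> poly (through x) y = 0"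
  using comps_proportional_quot by (auto simp: poly_through_eq_quot)

text \<open>In one fibre \<open>through x\<close> and \<open>through y\<close> are proportional, so
  whether the tangent line with parameter \<open>x\<close> touches the curve at \<open>y\<close>
  depends on \<open>y\<close> alone.\<close>

lemma poly_pderiv_comps_eq_0_iff:
  assumes "x \<noteq> y" "poly (through x) y = 0"
  shows "poly (pderiv (comps x)) y = 0 \<longleftrightarrow> poly w y = 0"
proof -
  obtain r where r: "r \<noteq> 0" "comps x = smult r (quot x)"
    using comps_proportional_quot by blast
  obtain s where s: "s \<noteq> 0" "through x = smult s (through y)"
    using through_proportional[OF assms(2)] by blast
  have "poly (quot x) y = 0"
    using assms by (simp add: poly_through_eq_quot)
  then have "(x - y) * poly (pderiv (quot x)) y = - s * poly w y"
    using poly_pderiv_through[of x y] s by (simp add: pderiv_smult poly_pderiv_through_self)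
  then show ?thesis
    using assms(1) r s by (auto simp: pderiv_smult)
qed

lemma no_triple_contact: "\<not> [:- y, 1:] ^ 3 dvd comps x"
proof
  assume "[:- y, 1:] ^ 3 dvd comps x"
  then have "[:- y, 1:] ^ 3 dvd through x"
    by (rule dvd_comps_imp_dvd_through)
  note 0 = cube_dvd_imp_triple_root[OF this]
  obtain s where s: "s \<noteq> 0" "through x = smult s (through y)"
    using through_proportional[OF 0(1)] by blast
  have "poly w y = 0" "poly (pderiv w) y = 0"
    using 0 s by (auto simp: pderiv_smult poly_pderiv_through_self poly_pderiv2_through_self)
  then show False
    using wronskian_squarefree by (auto simp: rsquarefree_roots)
qed

text \<open>Comparing top coefficients in \<open>y\<close> amounts to intersecting the curve and its
  components with the tangent line at infinity.\<close>

lemma through_infinity_proportional_prod: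
  "\<exists>r. r \<noteq> 0 \<and> smult r through_infinity =
    (\<Prod>j\<le>m. if j < m then [:c j, b j, a j:] else if l = 0 then [:g m:] else [:e m, d m:])"
proof -
  obtain r where r: "r \<noteq> 0" "\<And>x. comps x = smult r (quot x)"
    using comps_proportional_quot by blast
  have "poly (smult r through_infinity) x = poly (\<Prod>j\<le>m. if j < m then [:c j, b j, a j:]
      else if l = 0 then [:g m:] else [:e m, d m:]) x" for x
  proof -
    have "poly (smult r through_infinity) x = coeff (comps x) (n - 1)"
      using r coeff_quot_degree[of x] by simp
    also have "\<dots> = (\<Prod>j\<le>m. coeff (comp j x) (comp_deg j))"
      unfolding comps_def sum_comp_deg[symmetric] by (rule coeff_prod_sum) (auto simp: degree_comp_le)
    also have "\<dots> = (\<Prod>j\<le>m. poly (if j < m then [:c j, b j, a j:]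
      else if l = 0 then [:g m:] else [:e m, d m:]) x)"
    proof (intro prod.cong refl)
      fix j assume "j \<in> {..m}"
      then consider "j < m" | "j = m" "l = 0" | "j = m" "l = 1"
        using count(2) by fastforce
      then show "coeff (comp j x) (comp_deg j) = poly (if j < m then [:c j, b j, a j:]
          else if l = 0 then [:g m:] else [:e m, d m:]) x"
        unfolding comp_deg_def using line
        by cases (simp_all add: comp_def biquad_def numeral_eq_Suc)
    qed
    finally show ?thesis
      by (simp add: poly_prod)
  qed
  then have "smult r through_infinity =
    (\<Prod>j\<le>m. if j < m then [:c j, b j, a j:] else if l = 0 then [:g m:] else [:e m, d m:])"
    by (intro poly_eqI_nonzero)
  with r(1) show ?thesis by blast
qed

text \<open>The tangent line at infinity meets the curve in \<open>n - 1\<close> distinct points.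
  The other components account for at most \<open>n - 3\<close> of them, so the conic has two
  distinct ones.\<close>

lemma conic_not_tangent_at_infinity:
  assumes "i < m"
  shows "b i ^ 2 - 4 * a i * c i \<noteq> 0" and "poly [:c i, b i, a i:] x = 0 \<Longrightarrow> poly through_infinity x = 0"
proof -
  define A where
    "A = (\<lambda>j. if j < m then [:c j, b j, a j:] else if l = 0 then [:g m:] else [:e m, d m:])"
  obtain r where r: "r \<noteq> 0" "smult r through_infinity = (\<Prod>j\<le>m. A j)"
    using through_infinity_proportional_prod unfolding A_def by blast
  have A: "(\<Prod>j\<le>m. A j) = A i * (\<Prod>j\<in>{..m} - {i}. A j)"
    using assms by (subst prod.remove[of _ i]) auto
  have Ai: "A i = [:c i, b i, a i:]"
    using assms by (simp add: A_def)
  have ne: "(\<Prod>j\<le>m. A j) \<noteq> 0"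
    using r through_infinity_ne_0 by (metis smult_eq_0_iff)
  then have ne': "A i \<noteq> 0" "(\<Prod>j\<in>{..m} - {i}. A j) \<noteq> 0"
    unfolding A by auto
  have roots: "{x. poly through_infinity x = 0} =
      {x. poly (A i) x = 0} \<union> {x. poly (\<Prod>j\<in>{..m} - {i}. A j) x = 0}"
  proof -
    have "poly through_infinity x = 0 \<longleftrightarrow> poly (smult r through_infinity) x = 0" for x
      using r(1) by simp
    then show ?thesis
      unfolding r(2) A by auto
  qed
  then show "poly [:c i, b i, a i:] x = 0 \<Longrightarrow> poly through_infinity x = 0"
    using Ai by auto
  have "degree (A j) \<le> comp_deg j" if "j \<in> {..m} - {i}" for j
    using that count(2) by (auto simp: A_def comp_deg_def degree_pCons_le)
  then have "degree (\<Prod>j\<in>{..m} - {i}. A j) \<le> (\<Sum>j\<in>{..m} - {i}. comp_deg j)"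
    by (rule degree_prod_le_sum)
  moreover have "(\<Sum>j\<le>m. comp_deg j) = comp_deg i + (\<Sum>j\<in>{..m} - {i}. comp_deg j)"
    using assms by (subst sum.remove[of _ i]) auto
  ultimately have "card {x. poly (\<Prod>j\<in>{..m} - {i}. A j) x = 0} + 2 \<le> n - 1"
    using card_poly_roots_bound[OF ne'(2)] assms sum_comp_deg by (simp add: comp_deg_def)
  moreover have "n - 1 \<le> card {x. poly (A i) x = 0} + card {x. poly (\<Prod>j\<in>{..m} - {i}. A j) x = 0}"
    using card_Un_le[of "{x. poly (A i) x = 0}" "{x. poly (\<Prod>j\<in>{..m} - {i}. A j) x = 0}"]
      roots card_through_infinity by simp
  ultimately have "2 \<le> card {x. poly (A i) x = 0}"
    by linarith
  then show "b i ^ 2 - 4 * a i * c i \<noteq> 0"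
    using quadratic_two_roots_imp_disc ne'(1) unfolding Ai by blast
qed

text \<open>Infinity is at most a simple zero: the member that vanishes there has
  \<open>n - 1\<close> distinct finite roots.\<close>

lemma degree_through_ge: "n \<le> degree (through x) + 1"
proof (cases "poly through_infinity x = 0")
  case True
  then obtain r where r: "r \<noteq> 0" "through_infinity = smult r (through x)"
    using member_proportional[of "coeff \<phi> n" "coeff f n" x] lead_coeff_ne_0
    unfolding through_infinity_def by auto
  have "n - 1 \<le> degree through_infinity"
    using card_poly_roots_bound[OF through_infinity_ne_0] card_through_infinity by simp
  then show ?thesis
    using r by simp
next
  case False
  then have "coeff (through x) n \<noteq> 0"
    by (simp add: coeff_through_degree)
  then show ?thesis
    using le_degree[of "through x" n] by simp
qed

abbreviation disc :: "nat \<Rightarrow> complex poly" where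
  "disc i \<equiv> biquad_disc (a i) (b i) (c i) (d i) (e i) (g i)"

text \<open>Otherwise the conic would touch the tangent line of \<open>x\<close> at \<open>y\<close>
  = infinity, the degree on this line would drop by two, and infinity would be a double zero of a
  member.\<close>

lemma disc_zero_imp_finite:
  assumes "i < m" "poly (disc i) x = 0"
  shows "poly [:c i, b i, a i:] x \<noteq> 0"
proof
  assume A: "poly [:c i, b i, a i:] x = 0"
  then have B: "poly [:e i, d i, b i:] x = 0"
    using assms(2) unfolding poly_biquad_disc by simp
  have "degree (comp i x) = 0"
    using A B by (simp add: comp_def biquad_def)
  moreover have "degree (cofactor i x) + 2 \<le> n - 1"
  proof -
    have "degree (cofactor i x) \<le> (\<Sum>j\<in>{..m} - {i}. comp_deg j)"
      unfolding cofactor_def by (rule degree_prod_le_sum) (auto simp: degree_comp_le)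
    moreover have "(\<Sum>j\<le>m. comp_deg j) = comp_deg i + (\<Sum>j\<in>{..m} - {i}. comp_deg j)"
      using assms by (subst sum.remove[of _ i]) auto
    ultimately show ?thesis
      using assms sum_comp_deg by (simp add: comp_deg_def)
  qed
  ultimately have "degree (comps x) + 2 \<le> n - 1"
    using assms comps_eq[of i x] degree_mult_le[of "comp i x" "cofactor i x"] by simp
  moreover have "degree (comps x) = degree (quot x)"
    using comps_proportional_quot by (metis degree_smult_eq)
  ultimately show False
    using degree_through_ge[of x] degree_through_quot[of x] by linarith
qed

text \<open>If the tangent line of \<open>K\<close> at \<open>x\<close> touches the conic \<open>i\<close>, it does so at the point with Darboux
  coordinates \<open>x\<close> and \<open>contact i x\<close>.\<close>

definition contact :: "nat \<Rightarrow> complex \<Rightarrow> complex" where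
  "contact i x = - poly [:e i, d i, b i:] x / (2 * poly [:c i, b i, a i:] x)"

lemma contact_double_root:
  assumes "i < m" "poly (disc i) x = 0"
  shows "poly (comp i x) (contact i x) = 0" "poly (pderiv (comp i x)) (contact i x) = 0"
  using biquad_disc_double_root[OF assms(2) disc_zero_imp_finite[OF assms]]
  unfolding comp_def contact_def by blast+

lemma wronskian_proportional_prod_diag:
  "\<exists>r. r \<noteq> 0 \<and> smult r w = (\<Prod>j\<le>m. biquad_diag (a j) (b j) (c j) (d j) (e j) (g j))"
proof -
  obtain r where r: "r \<noteq> 0" "\<And>x. comps x = smult r (quot x)"
    using comps_proportional_quot by blast
  have "poly (smult r w) x = poly (\<Prod>j\<le>m. biquad_diag (a j) (b j) (c j) (d j) (e j) (g j)) x" for x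
  proof -
    have "poly (smult r w) x = poly (comps x) x"
      using r by (simp add: poly_quot_self)
    then show ?thesis
      by (simp add: comps_def poly_prod poly_biquad_diag comp_def)
  qed
  with r(1) show ?thesis
    by (intro exI[of _ r]) (auto intro: poly_eqI_nonzero)
qed

text \<open>Otherwise the conic would touch K itself: by symmetry the derivative of
  \<open>biquad_diag\<close> is twice a partial derivative, so \<open>w\<close> would have a double
  zero.\<close>

lemma contact_ne:
  assumes "i < m" "poly (disc i) x = 0"
  shows "contact i x \<noteq> x"
proof
  assume "contact i x = x"
  then have "poly (comp i x) x = 0" "poly (pderiv (comp i x)) x = 0"
    using contact_double_root[OF assms] by auto
  then have "[:- x, 1:] ^ 2 dvd biquad_diag (a i) (b i) (c i) (d i) (e i) (g i)"
    unfolding square_dvd_iff_double_root by (simp add: poly_biquad_diag poly_pderiv_biquad_diag comp_def)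
  then have "[:- x, 1:] ^ 2 dvd (\<Prod>j\<le>m. biquad_diag (a j) (b j) (c j) (d j) (e j) (g j))"
    using assms(1) by (intro dvd_trans[OF _ dvd_prodI[of "{..m}" i]]) auto
  then have "[:- x, 1:] ^ 2 dvd w"
    using wronskian_proportional_prod_diag by (metis dvd_smult_iff)
  then show False
    using wronskian_squarefree unfolding square_dvd_iff_double_root by (auto simp: rsquarefree_roots)
qed

lemma contact_smooth:
  assumes "i < m" "poly (disc i) x = 0"
  shows "poly (pderiv (comp i (contact i x))) x \<noteq> 0"
  using nonsingular[of i x "contact i x"] contact_ne[OF assms] contact_double_root[OF assms] assms(1)
  by (auto simp: comp_def)

text \<open>The degree is 4 because infinity is not the parameter of a common tangent. A root is
  simple because the derivative there is a nonzero multiple of a partial derivative at the contact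
  point, and the conic is smooth at that point.\<close>

lemma card_disc_roots:
  assumes "i < m"
  shows "card {x. poly (disc i) x = 0} = 4"
proof -
  have "rsquarefree (disc i)"
    unfolding rsquarefree_roots
  proof (intro allI notI, elim conjE)
    fix x assume x: "poly (disc i) x = 0" "poly (pderiv (disc i)) x = 0"
    show False
      using poly_pderiv_biquad_disc[OF x(1) disc_zero_imp_finite[OF assms x(1)]] x(2)
        disc_zero_imp_finite[OF assms x(1)] contact_smooth[OF assms x(1)]
      unfolding contact_def comp_def by (metis mult_eq_0_iff neg_equal_0_iff_equal zero_neq_numeral)
  qed
  moreover have "degree (disc i) = 4"
    using degree_biquad_disc_le le_degree[of "disc i" 4] conic_not_tangent_at_infinity(1)[OF assms]
    by (metis antisym coeff_biquad_disc_4)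
  ultimately show ?thesis
    by (simp add: rsquarefree_card_roots)
qed

text \<open>A second component through the point of contact would give \<open>through x\<close> a triple root.\<close>

lemma contact_cofactor:
  assumes "i < m" "poly (disc i) x = 0"
  shows "poly (cofactor i x) (contact i x) \<noteq> 0"
proof
  assume "poly (cofactor i x) (contact i x) = 0"
  then have "[:- contact i x, 1:] dvd cofactor i x"
    by (simp add: poly_eq_0_iff_dvd)
  moreover have "[:- contact i x, 1:] ^ 2 dvd comp i x"
    using contact_double_root[OF assms] by (simp add: square_dvd_iff_double_root)
  ultimately have "[:- contact i x, 1:] ^ 2 * [:- contact i x, 1:] dvd comps x"
    using comps_eq[of i x] assms(1) mult_dvd_mono by (metis less_imp_le)
  then show False
    using no_triple_contact[of "contact i x" x] by (simp add: power3_eq_cube power2_eq_square)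
qed

lemma contact_inj:
  assumes "i < m" "poly (disc i) x = 0" "j < m" "poly (disc j) x = 0" "contact i x = contact j x"
  shows "i = j"
proof (rule ccontr)
  assume "i \<noteq> j"
  then have "poly (cofactor i x) (contact i x) = 0"
    using contact_double_root(1)[OF assms(3,4)] assms(3,5) unfolding cofactor_def poly_prod
    by (intro prod_zero) auto
  then show False
    using contact_cofactor[OF assms(1,2)] by simp
qed

lemma contact_in_fibre:
  assumes "i < m" "poly (disc i) x = 0"
  shows "poly (through x) (contact i x) = 0" "poly w (contact i x) = 0" "poly w x \<noteq> 0"
proof -
  define y where "y = contact i x"
  have le: "i \<le> m" using assms by simp
  have ne: "x \<noteq> y"
    using contact_ne[OF assms] by (simp add: y_def)
  have C: "poly (comp i x) y = 0" "poly (pderiv (comp i x)) y = 0"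
    using contact_double_root[OF assms] by (auto simp: y_def)
  have "poly (comps x) y = 0" "poly (pderiv (comps x)) y = 0"
    unfolding comps_eq[OF le] pderiv_mult using C by simp_all
  then show *: "poly (through x) (contact i x) = 0" "poly w (contact i x) = 0"
    using ne poly_comps_eq_0_iff[of x y] poly_pderiv_comps_eq_0_iff[of x y] by (auto simp: y_def)
  \<comment> \<open>The same point is now viewed on the tangent line with parameter
    \<open>y\<close>: it is a simple intersection, as the conic is smooth and no other component
    passes, so \<open>x\<close> is a simple root of the member.\<close>
  have "poly (through y) x = 0"
    using * through_sym[of x y] by (simp add: y_def)
  moreover have "poly (pderiv (comps y)) x \<noteq> 0"
  proof -
    have "poly (comp i y) x = 0"
      using C comp_sym[of i x y] by simp
    moreover have "poly (cofactor i y) x \<noteq> 0"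
      using contact_cofactor[OF assms] cofactor_sym[of i x y] by (simp add: y_def)
    moreover have "poly (pderiv (comp i y)) x \<noteq> 0"
      using contact_smooth[OF assms] by (simp add: y_def)
    ultimately show ?thesis
      unfolding comps_eq[OF le] pderiv_mult by simp
  qed
  ultimately show "poly w x \<noteq> 0"
    using ne poly_pderiv_comps_eq_0_iff[of y x] by simp
qed

text \<open>On the tangent line of \<open>y\<close> the intersection is simple, so only one
  component passes through the point; on that of \<open>x\<close> it is double, so this component
  touches the line.\<close>

lemma contact_surj:
  assumes "poly (through x) y = 0" "poly w y = 0" "poly w x \<noteq> 0"
  shows "\<exists>i<m. poly (disc i) x = 0 \<and> contact i x = y"
proof -
  have ne: "x \<noteq> y"
    using assms by auto
  have "poly (comps x) y = 0" "poly (pderiv (comps x)) y = 0"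
    using assms ne by (simp_all add: poly_comps_eq_0_iff poly_pderiv_comps_eq_0_iff)
  then obtain j where j: "j \<le> m" "poly (comp j x) y = 0"
    by (auto simp: comps_def poly_prod)
  have "poly (through y) x = 0"
    using assms(1) through_sym[of x y] by simp
  then have "poly (pderiv (comps y)) x \<noteq> 0"
    using ne assms(3) by (simp add: poly_pderiv_comps_eq_0_iff)
  then have "poly (cofactor j y) x \<noteq> 0"
    using j comp_sym[of j x y] unfolding comps_eq[OF j(1)] pderiv_mult by auto
  then have "poly (pderiv (comp j x)) y = 0"
    using \<open>poly (pderiv (comps x)) y = 0\<close> j cofactor_sym[of j x y]
    unfolding comps_eq[OF j(1)] pderiv_mult by simp
  note * = biquad_double_root_imp_disc[OF comp_nonzero[OF j(1), of x, unfolded comp_def]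
      j(2)[unfolded comp_def] this[unfolded comp_def]]
  \<comment> \<open>The component with index \<open>m\<close> has no term of degree 2 in
    \<open>y\<close> and therefore no double root.\<close>
  have "j \<noteq> m"
    using *(1) line by auto
  then have "j < m"
    using j(1) by simp
  then show ?thesis
    using *(2,3) unfolding contact_def by metis
qed

lemma card_contacts:
  "card {(x, y). poly w x \<noteq> 0 \<and> poly w y = 0 \<and> poly (through x) y = 0} = 4 * m"
proof -
  have "bij_betw (\<lambda>(i, x). (x, contact i x)) (SIGMA i:{..<m}. {x. poly (disc i) x = 0})
      {(x, y). poly w x \<noteq> 0 \<and> poly w y = 0 \<and> poly (through x) y = 0}"
    unfolding bij_betw_def
  proof
    show "inj_on (\<lambda>(i, x). (x, contact i x)) (SIGMA i:{..<m}. {x. poly (disc i) x = 0})"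
      by (auto simp: inj_on_def intro: contact_inj)
    show "(\<lambda>(i, x). (x, contact i x)) ` (SIGMA i:{..<m}. {x. poly (disc i) x = 0}) =
        {(x, y). poly w x \<noteq> 0 \<and> poly w y = 0 \<and> poly (through x) y = 0}"
    proof (intro equalityI subsetI)
      fix p assume "p \<in> (\<lambda>(i, x). (x, contact i x)) ` (SIGMA i:{..<m}. {x. poly (disc i) x = 0})"
      then show "p \<in> {(x, y). poly w x \<noteq> 0 \<and> poly w y = 0 \<and> poly (through x) y = 0}"
        using contact_in_fibre by auto
    next
      fix p assume "p \<in> {(x, y). poly w x \<noteq> 0 \<and> poly w y = 0 \<and> poly (through x) y = 0}"
      then obtain x y where p: "p = (x, y)" "poly w x \<noteq> 0" "poly w y = 0" "poly (through x) y = 0"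
        by blast
      then obtain i where "i < m" "poly (disc i) x = 0" "contact i x = y"
        using contact_surj by blast
      then show "p \<in> (\<lambda>(i, x). (x, contact i x)) ` (SIGMA i:{..<m}. {x. poly (disc i) x = 0})"
        using p(1) by (force intro: image_eqI[of _ _ "(i, x)"])
    qed
  qed
  moreover have "card (SIGMA i:{..<m}. {x. poly (disc i) x = 0}) = (\<Sum>i<m. card {x. poly (disc i) x = 0})"
  proof (rule card_SigmaI)
    show "\<forall>i\<in>{..<m}. finite {x. poly (disc i) x = 0}"
      using card_disc_roots by (metis card.infinite lessThan_iff zero_neq_numeral)
  qed simp
  ultimately show ?thesis
    using card_disc_roots by (auto dest!: bij_betw_same_card)
qed

end

section \<open>Fibres of the map from CP^1 to the parameter line of the pencil\<close>

context coprime_pencil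
begin

definition fibre :: "complex option \<Rightarrow> complex set" where
  "fibre t = {y. poly (pencil \<phi> f t) y = 0}"

definition parameter :: "complex \<Rightarrow> complex option" where
  "parameter y = (if poly f y = 0 then None else Some (- poly \<phi> y / poly f y))"

lemma pencil_member: "\<exists>\<alpha> \<beta>. (\<alpha>, \<beta>) \<noteq> (0, 0) \<and> pencil \<phi> f t = member \<alpha> \<beta>"
proof (cases t)
  case None
  then show ?thesis
    by (intro exI[of _ 1] exI[of _ 0]) (simp add: member_def)
next
  case (Some s)
  then show ?thesis
    by (intro exI[of _ s] exI[of _ "- 1"]) (simp add: member_def)
qed

lemma pencil_ne_0: "pencil \<phi> f t \<noteq> 0"
  using pencil_member[of t] member_ne_0 by auto

lemma degree_pencil_le: "degree (pencil \<phi> f t) \<le> n"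
  using pencil_member[of t] degree_member_le by auto

lemma fibre_iff: "y \<in> fibre t \<longleftrightarrow> parameter y = t"
proof (cases t)
  case (Some s)
  have "poly \<phi> y + s * poly f y = 0 \<longleftrightarrow> poly f y \<noteq> 0 \<and> - poly \<phi> y / poly f y = s"
  proof (cases "poly f y = 0")
    case True
    then show ?thesis
      using no_common_zero by auto
  next
    case False
    have "poly \<phi> y + s * poly f y = 0 \<longleftrightarrow> - poly \<phi> y = s * poly f y"
      unfolding add_eq_0_iff by (rule eq_commute)
    then show ?thesis
      using False nonzero_divide_eq_eq[OF False, of "- poly \<phi> y" s] by metis
  qed
  then show ?thesis
    using Some by (auto simp: fibre_def parameter_def)
qed (simp add: fibre_def parameter_def)

lemma through_zero_iff: "poly (through x) y = 0 \<longleftrightarrow> parameter x = parameter y"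
proof
  assume "poly (through x) y = 0"
  then have eq: "poly \<phi> x * poly f y = poly f x * poly \<phi> y"
    by (simp add: poly_through)
  moreover have "poly f x = 0 \<longleftrightarrow> poly f y = 0"
    using eq no_common_zero by auto
  ultimately show "parameter x = parameter y"
    by (auto simp: parameter_def field_simps)
next
  assume "parameter x = parameter y"
  then show "poly (through x) y = 0"
    by (auto simp: parameter_def poly_through field_simps split: if_splits)
qed

lemma finite_fibre: "finite (fibre t)"
  unfolding fibre_def by (rule poly_roots_finite[OF pencil_ne_0])

lemma degree_pencil_eq:
  assumes "rsquarefree w"
  shows "degree (pencil \<phi> f t) = card (fibre t) + card (fibre t \<inter> {y. poly w y = 0})"
proof -
  obtain \<alpha> \<beta> where mem: "(\<alpha>, \<beta>) \<noteq> (0, 0)" "pencil \<phi> f t = member \<alpha> \<beta>"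
    using pencil_member by blast
  have "degree (pencil \<phi> f t) = (\<Sum>y\<in>fibre t. order y (pencil \<phi> f t))"
    unfolding fibre_def by (rule sum_order_eq_degree[OF pencil_ne_0, symmetric])
  also have "\<dots> = (\<Sum>y\<in>fibre t. 1 + (if poly w y = 0 then 1 else 0))"
    using mem assms by (intro sum.cong refl) (auto simp: fibre_def order_member_root)
  also have "\<dots> = card (fibre t) + card (fibre t \<inter> {y. poly w y = 0})"
    unfolding sum.distrib using finite_fibre by (simp add: sum.If_cases)
  finally show ?thesis .
qed

lemma sum_over_parameters:
  fixes h :: "'a \<Rightarrow> complex"
  assumes "finite A" "finite Z" "\<And>p. p \<in> A \<Longrightarrow> h p \<in> Z"
  shows "card A = (\<Sum>t\<in>parameter ` Z. card {p \<in> A. parameter (h p) = t})"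
  using sum.group[of A "parameter ` Z" "\<lambda>p. parameter (h p)" "\<lambda>_. 1::nat"] assms
  by (simp add: image_subset_iff)

end

section \<open>The two counts over the branch values\<close>

context decomposed_pencil
begin

definition mult :: "complex option \<Rightarrow> nat" where
  "mult t = card (fibre t \<inter> {y. poly w y = 0})"

text \<open>The only member of smaller degree is \<open>through_infinity\<close>, up to a factor,
  and genericity of infinity makes all its roots simple.\<close>

lemma degree_pencil_less:
  assumes "degree (pencil \<phi> f t) < n"
  shows "card (fibre t) = n - 1" "mult t = 0"
proof -
  obtain \<alpha> \<beta> where mem: "(\<alpha>, \<beta>) \<noteq> (0, 0)" "pencil \<phi> f t = member \<alpha> \<beta>"
    using pencil_member by blast
  have "coeff (member \<alpha> \<beta>) n = 0"
    using assms mem(2) by (simp add: coeff_eq_0)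
  then have eq: "\<alpha> * coeff f n = \<beta> * coeff \<phi> n"
    by (simp add: member_def)
  define r where "r = \<alpha> / coeff \<phi> n"
  have "\<alpha> = r * coeff \<phi> n" "\<beta> = r * coeff f n"
    using eq lead_coeff_ne_0 by (simp_all add: r_def field_simps)
  then have "r \<noteq> 0" "member \<alpha> \<beta> = smult r through_infinity"
    using mem(1) by (auto simp: through_infinity_def member_def smult_diff_right)
  then have "fibre t = {y. poly through_infinity y = 0}"
    unfolding fibre_def mem(2) by simp
  then show "card (fibre t) = n - 1"
    using card_through_infinity by simp
  then show "mult t = 0"
    using degree_pencil_eq[OF wronskian_squarefree, of t] assms by (simp add: mult_def)
qed

text \<open>This expresses \<open>mult\<close> by distinct zeros in CP^1, the form in which it can
  be transported back to the original coordinates.\<close>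

lemma proj_roots_pencil: "proj_roots n (pencil \<phi> f t) + mult t = n"
proof (cases "degree (pencil \<phi> f t) < n")
  case True
  then show ?thesis
    using degree_pencil_less[OF True] n by (simp add: proj_roots_def fibre_def)
next
  case False
  then show ?thesis
    using degree_pencil_eq[OF wronskian_squarefree, of t] degree_pencil_le[of t]
    by (simp add: proj_roots_def fibre_def mult_def)
qed

definition branch :: "complex option set" where
  "branch = parameter ` {y. poly w y = 0}"

lemma finite_branch: "finite branch"
  using wronskian_ne_0 by (simp add: branch_def poly_roots_finite)

lemma mult_pos_iff: "mult t > 0 \<longleftrightarrow> t \<in> branch"
  using finite_fibre[of t] by (auto simp: mult_def branch_def card_gt_0_iff fibre_iff)

lemma card_simple_roots:
  assumes "t \<in> branch"
  shows "card (fibre t - {y. poly w y = 0}) = n - 2 * mult t" "2 * mult t \<le> n"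
proof -
  have "degree (pencil \<phi> f t) = n"
    using assms degree_pencil_less(2)[of t] mult_pos_iff[of t] degree_pencil_le[of t] by fastforce
  then have eq: "card (fibre t) + mult t = n"
    using degree_pencil_eq[OF wronskian_squarefree, of t] by (simp add: mult_def)
  have "mult t \<le> card (fibre t)"
    unfolding mult_def using finite_fibre by (intro card_mono) auto
  moreover have "card (fibre t - {y. poly w y = 0}) = card (fibre t) - mult t"
    unfolding mult_def using finite_fibre by (intro card_Diff_subset_Int) auto
  ultimately show "card (fibre t - {y. poly w y = 0}) = n - 2 * mult t" "2 * mult t \<le> n"
    using eq by linarith+
qed

lemma sum_mult: "(\<Sum>t\<in>branch. mult t) = 2 * n - 2"
proof -
  have fin: "finite {y. poly w y = 0}"
    using wronskian_ne_0 by (rule poly_roots_finite)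
  have "card {y. poly w y = 0} = (\<Sum>t\<in>branch. card {y \<in> {y. poly w y = 0}. parameter y = t})"
    unfolding branch_def using fin by (intro sum_over_parameters[where h = "\<lambda>y. y"]) auto
  also have "\<dots> = (\<Sum>t\<in>branch. mult t)"
    unfolding mult_def by (intro sum.cong refl arg_cong[where f = card]) (auto simp: fibre_iff)
  finally show ?thesis
    using rsquarefree_card_roots[OF wronskian_squarefree] degree_wronskian by simp
qed

lemma sum_mult_simple: "(\<Sum>t\<in>branch. mult t * (n - 2 * mult t)) = 4 * m"
proof -
  define Z where "Z = {y. poly w y = 0}"
  define E where "E = {(x, y). poly w x \<noteq> 0 \<and> poly w y = 0 \<and> poly (through x) y = 0}"
  have fin: "finite Z"
    unfolding Z_def using wronskian_ne_0 by (rule poly_roots_finite)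
  have "E \<subseteq> (\<Union>y\<in>Z. fibre (parameter y) \<times> {y})"
    by (auto simp: E_def Z_def fibre_iff through_zero_iff)
  moreover have "finite (\<Union>y\<in>Z. fibre (parameter y) \<times> {y})"
    using fin finite_fibre by blast
  ultimately have "finite E"
    by (rule finite_subset)
  have "card E = (\<Sum>t\<in>branch. card {p \<in> E. parameter (snd p) = t})"
    unfolding branch_def Z_def[symmetric]
    using fin \<open>finite E\<close> by (intro sum_over_parameters) (auto simp: E_def Z_def)
  also have "\<dots> = (\<Sum>t\<in>branch. mult t * (n - 2 * mult t))"
  proof (intro sum.cong refl)
    fix t assume t: "t \<in> branch"
    have "{p \<in> E. parameter (snd p) = t} = (fibre t - Z) \<times> (fibre t \<inter> Z)"
      by (auto simp: E_def Z_def fibre_iff through_zero_iff)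
    then show "card {p \<in> E. parameter (snd p) = t} = mult t * (n - 2 * mult t)"
      using card_simple_roots(1)[OF t]
      by (simp add: card_cartesian_product mult_def Z_def mult.commute)
  qed
  finally show ?thesis
    using card_contacts unfolding E_def by simp
qed

end

section \<open>The arithmetic of the multiplicities\<close>

lemma list4_of_card_4:
  assumes "card A = 4"
  obtains t1 t2 t3 t4 where "distinct [t1, t2, t3, t4]" "A = {t1, t2, t3, t4}"
proof -
  have "finite A"
    using assms card.infinite by fastforce
  then obtain xs where xs: "set xs = A" "distinct xs"
    using finite_distinct_list by blast
  then have "length xs = 4"
    using assms distinct_card by fastforce
  then obtain t1 t2 t3 t4 where "xs = [t1, t2, t3, t4]"
    by (auto simp: numeral_eq_Suc length_Suc_conv)
  with xs that show ?thesis
    by auto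
qed

text \<open>The difference of the two sums has the nonnegative terms
  \<open>\<mu> t * (2 * k - 2 * \<mu> t)\<close> and is 0, so \<open>\<mu>\<close> equals
  \<open>k\<close> on \<open>T\<close>; the first sum then gives four values. For
  \<open>k = 0\<close> the set \<open>T\<close> is empty and any four values will do.\<close>

lemma four_values_odd:
  fixes \<mu> :: "'a \<Rightarrow> nat"
  assumes "infinite (UNIV :: 'a set)" "finite T" "\<And>t. t \<notin> T \<Longrightarrow> \<mu> t = 0"
    and "\<And>t. t \<in> T \<Longrightarrow> 1 \<le> \<mu> t \<and> 2 * \<mu> t \<le> 2 * k + 1"
    and "(\<Sum>t\<in>T. \<mu> t) = 4 * k" "(\<Sum>t\<in>T. \<mu> t * (2 * k + 1 - 2 * \<mu> t)) = 4 * k"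
  shows "\<exists>t1 t2 t3 t4. distinct [t1, t2, t3, t4] \<and> \<mu> t1 = k \<and> \<mu> t2 = k \<and> \<mu> t3 = k \<and> \<mu> t4 = k"
proof -
  obtain A where A: "card A = 4" "\<And>t. t \<in> A \<Longrightarrow> \<mu> t = k"
  proof (cases "k = 0")
    case True
    then have "T = {}"
      using assms(2,4,5) by fastforce
    moreover obtain A :: "'a set" where "card A = 4"
      using infinite_arbitrarily_large[OF assms(1)] by blast
    ultimately show ?thesis
      using that True assms(3) by blast
  next
    case False
    have "(\<Sum>t\<in>T. \<mu> t * (2 * k + 1 - 2 * \<mu> t)) = (\<Sum>t\<in>T. \<mu> t + \<mu> t * (2 * k - 2 * \<mu> t))"
    proof (intro sum.cong refl)
      fix t assume "t \<in> T"
      then have "2 * k + 1 - 2 * \<mu> t = 1 + (2 * k - 2 * \<mu> t)"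
        using assms(4)[of t] by presburger
      then show "\<mu> t * (2 * k + 1 - 2 * \<mu> t) = \<mu> t + \<mu> t * (2 * k - 2 * \<mu> t)"
        by (simp add: distrib_left)
    qed
    then have "(\<Sum>t\<in>T. \<mu> t * (2 * k - 2 * \<mu> t)) = 0"
      using assms(5,6) by (simp add: sum.distrib)
    then have "\<forall>t\<in>T. \<mu> t * (2 * k - 2 * \<mu> t) = 0"
      using assms(2) by simp
    then have k: "\<mu> t = k" if "t \<in> T" for t
      using assms(4)[OF that] that by fastforce
    then have "card T * k = 4 * k"
      using assms(5) by simp
    then show ?thesis
      using that[of T] k False by simp
  qed
  then show ?thesis
    by (metis (no_types, lifting) list4_of_card_4 insertCI)
qed

text \<open>\<open>\<mu> * (k - \<mu>)\<close> exceeds \<open>k - 1\<close> by exactly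
  \<open>(\<mu> - 1) * (k - \<mu> - 1)\<close>.\<close>

lemma product_lower_bound:
  fixes \<mu> k :: nat
  assumes "1 \<le> \<mu>" "\<mu> < k"
  shows "k - 1 \<le> \<mu> * (k - \<mu>)" "\<mu> * (k - \<mu>) = k - 1 \<Longrightarrow> \<mu> = 1 \<or> \<mu> = k - 1"
proof -
  obtain i where i: "\<mu> = Suc i"
    using assms(1) by (cases \<mu>) auto
  obtain j where "k = Suc (\<mu> + j)"
    using less_imp_Suc_add[OF assms(2)] by blast
  with i have ij: "\<mu> = Suc i" "k = Suc (Suc (i + j))"
    by simp_all
  have eq: "\<mu> * (k - \<mu>) = k - 1 + i * j"
    by (simp add: ij)
  then show "k - 1 \<le> \<mu> * (k - \<mu>)" by simp
  assume "\<mu> * (k - \<mu>) = k - 1"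
  then have "i = 0 \<or> j = 0"
    using eq by simp
  then show "\<mu> = 1 \<or> \<mu> = k - 1"
    by (auto simp: ij)
qed

text \<open>Only values below \<open>k\<close> enter the second sum. Half of it is
  \<open>2 * (k - 1)\<close>, and each such value contributes at least \<open>k - 1\<close>; so for
  \<open>k > 1\<close> there are at most two, and two of them must be 1 or \<open>k - 1\<close>. The
  first sum decides the rest.\<close>

lemma four_or_five_values_even:
  fixes \<mu> :: "'a \<Rightarrow> nat"
  assumes "infinite (UNIV :: 'a set)" "finite T" "\<And>t. t \<notin> T \<Longrightarrow> \<mu> t = 0"
    and "\<And>t. t \<in> T \<Longrightarrow> 1 \<le> \<mu> t \<and> \<mu> t \<le> k" "1 \<le> k"
    and "(\<Sum>t\<in>T. \<mu> t) = 4 * k - 2" "(\<Sum>t\<in>T. \<mu> t * (2 * k - 2 * \<mu> t)) = 4 * (k - 1)"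
  shows "(\<exists>t1 t2 t3 t4. distinct [t1, t2, t3, t4] \<and>
      \<mu> t1 = k \<and> \<mu> t2 = k \<and> \<mu> t3 = k - 1 \<and> \<mu> t4 = k - 1) \<or>
    (k = 4 \<and> (\<exists>t1 t2 t3 t4 t5. distinct [t1, t2, t3, t4, t5] \<and>
      \<mu> t1 = 4 \<and> \<mu> t2 = 4 \<and> \<mu> t3 = 4 \<and> \<mu> t4 = 1 \<and> \<mu> t5 = 1))"
proof -
  define A where "A = {t\<in>T. \<mu> t = k}"
  define B where "B = {t\<in>T. \<mu> t < k}"
  have fin: "finite A" "finite B" and T: "T = A \<union> B" and disj: "A \<inter> B = {}"
    using assms(2,4) by (auto simp: A_def B_def le_less)
  have A: "\<mu> t = k" if "t \<in> A" for t
    using that by (simp add: A_def)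
  have B: "1 \<le> \<mu> t" "\<mu> t < k" if "t \<in> B" for t
    using that assms(4) by (auto simp: B_def)
  have sum1: "card A * k + (\<Sum>t\<in>B. \<mu> t) = 4 * k - 2"
    using assms(6) A unfolding T by (simp add: sum.union_disjoint[OF fin disj])
  have "(\<Sum>t\<in>T. \<mu> t * (2 * k - 2 * \<mu> t)) = 2 * (\<Sum>t\<in>B. \<mu> t * (k - \<mu> t))"
    unfolding T using A
    by (simp add: sum.union_disjoint[OF fin disj] sum_distrib_left algebra_simps flip: diff_mult_distrib2)
  then have sum2: "(\<Sum>t\<in>B. \<mu> t * (k - \<mu> t)) = 2 * (k - 1)"
    using assms(7) by simp
  have "(\<Sum>t\<in>B. k - 1) \<le> (\<Sum>t\<in>B. \<mu> t * (k - \<mu> t))"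
    using B by (intro sum_mono product_lower_bound)
  then have cardB: "card B * (k - 1) \<le> 2 * (k - 1)"
    unfolding sum2 by simp
  have two: "\<exists>t1 t2. t1 \<noteq> t2 \<and> X = {t1, t2}" if "card X = 2" for X :: "'a set"
    using that by (auto simp: card_2_iff)
  show ?thesis
  proof (cases "k = 1")
    case True
    then have "B = {}"
      using B by fastforce
    with sum1 True have "card A = 2" by simp
    then obtain t1 t2 where t12: "t1 \<noteq> t2" "A = {t1, t2}"
      using two by blast
    \<comment> \<open>Here \<open>k - 1 = 0\<close>, so any two values outside \<open>A\<close> can
      serve as \<open>t3\<close> and \<open>t4\<close>.\<close>
    have "infinite (- A)"
      using assms(1) fin(1) by (simp add: Compl_eq_Diff_UNIV)
    then obtain X where "X \<subseteq> - A" "card X = 2"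
      using infinite_arbitrarily_large by blast
    then obtain t3 t4 where t34: "t3 \<noteq> t4" "{t3, t4} \<subseteq> - A"
      using two by metis
    have "\<mu> t3 = 0" "\<mu> t4 = 0"
      using t34 assms(3) T \<open>B = {}\<close> by auto
    then show ?thesis
      using True t12 t34 A by (intro disjI1 exI[of _ t1] exI[of _ t2] exI[of _ t3] exI[of _ t4]) auto
  next
    case False
    then have k: "k \<ge> 2"
      using assms(5) by simp
    have "card A * k < 4 * k"
      using sum1 k by linarith
    then have "card A < 4"
      by simp
    then have A4: "card A = 0 \<or> card A = 1 \<or> card A = 2 \<or> card A = 3"
      by linarith
    have "card B \<le> 2"
      using cardB k by simp
    then consider "card B = 0" | "card B = 1" | "card B = 2"
      by linarith
    then show ?thesis
    proof cases
      case 1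
      then have "B = {}"
        using fin by simp
      then show ?thesis
        using sum2 k by simp
    next
      case 2
      then obtain t where t: "B = {t}"
        by (auto simp: card_1_singleton_iff)
      have "card A * k + \<mu> t = 4 * k - 2" "\<mu> t < k"
        using sum1 B[of t] t by auto
      then have "k = \<mu> t + 2"
        using A4 k by auto
      then show ?thesis
        using sum2 t by simp
    next
      case 3
      then obtain s t where st: "s \<noteq> t" "B = {s, t}"
        using two by blast
      have sum: "card A * k + \<mu> s + \<mu> t = 4 * k - 2"
        and "\<mu> s * (k - \<mu> s) + \<mu> t * (k - \<mu> t) = 2 * (k - 1)"
        using sum1 sum2 st by auto
      moreover have "k - 1 \<le> \<mu> s * (k - \<mu> s)" "k - 1 \<le> \<mu> t * (k - \<mu> t)"
        using B st product_lower_bound(1) by auto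
      ultimately have "\<mu> s * (k - \<mu> s) = k - 1" "\<mu> t * (k - \<mu> t) = k - 1"
        by linarith+
      then have \<mu>: "\<mu> s = 1 \<or> \<mu> s = k - 1" "\<mu> t = 1 \<or> \<mu> t = k - 1"
        using B st product_lower_bound(2) by auto
      \<comment> \<open>Two values 1 give \<open>card A * k = 4 * k - 4\<close>, so \<open>k\<close>
        divides 4; values 1 and \<open>k - 1\<close> give \<open>card A * k = 3 * k - 2\<close>, so
        \<open>k\<close> divides 2. For \<open>k = 2\<close> the numbers 1 and \<open>k - 1\<close>
        coincide, and only \<open>k = 4\<close> is new.\<close>
      have "(card A = 2 \<and> \<mu> s = k - 1 \<and> \<mu> t = k - 1) \<or> (k = 4 \<and> card A = 3 \<and> \<mu> s = 1 \<and> \<mu> t = 1)"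
        using sum \<mu> A4 k by auto
      then show ?thesis
      proof (elim disjE conjE)
        assume *: "card A = 2" "\<mu> s = k - 1" "\<mu> t = k - 1"
        then obtain t1 t2 where t12: "t1 \<noteq> t2" "A = {t1, t2}"
          using two by blast
        then have "distinct [t1, t2, s, t]"
          using st disj by auto
        then show ?thesis
          using * A t12 by blast
      next
        assume *: "k = 4" "card A = 3" "\<mu> s = 1" "\<mu> t = 1"
        then obtain t1 t2 t3 where t123: "A = {t1, t2, t3}" "t1 \<noteq> t2" "t2 \<noteq> t3" "t1 \<noteq> t3"
          by (auto simp: card_3_iff)
        then have "distinct [t1, t2, t3, s, t]"
          using st disj by auto
        moreover have "\<mu> t1 = 4" "\<mu> t2 = 4" "\<mu> t3 = 4"
          using A t123 *(1) by auto
        ultimately show ?thesis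
          using * by blast
      qed
    qed
  qed
qed

section \<open>Linear substitution in forms\<close>

lemma is_form_mult_linear:
  assumes "is_form d F"
  shows "is_form (Suc d) (\<lambda>z0 z1 z2. (p * z0 + q * z1 + r * z2) * F z0 z1 z2)"
proof -
  have "is_form (Suc d) (\<lambda>z0 z1 z2. (p * (z0 * F z0 z1 z2) + q * (z1 * F z0 z1 z2)) + r * (z2 * F z0 z1 z2))"
    by (intro is_form_add is_form_scale is_form_mult_z0 is_form_mult_z1 is_form_mult_z2 assms)
  then show ?thesis
    by (simp add: algebra_simps)
qed

lemma is_form_mult_linear_power:
  assumes "is_form d F"
  shows "is_form (i + d) (\<lambda>z0 z1 z2. (p * z0 + q * z1 + r * z2) ^ i * F z0 z1 z2)"
proof (induction i)
  case (Suc i)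
  then show ?case
    using is_form_mult_linear[OF Suc, of p q r] by (simp add: mult.assoc)
qed (simp add: assms)

lemma is_form_linear_subst:
  assumes "is_form d F"
  shows "is_form d (\<lambda>z0 z1 z2. F (p0 * z0 + q0 * z1 + r0 * z2) (p1 * z0 + q1 * z1 + r1 * z2)
    (p2 * z0 + q2 * z1 + r2 * z2))"
proof -
  obtain c where c: "\<And>z0 z1 z2. F z0 z1 z2 =
      (\<Sum>i\<le>d. \<Sum>j\<le>d - i. c i j * z0 ^ i * z1 ^ j * z2 ^ (d - i - j))"
    using assms unfolding is_form_def by blast
  have "is_form d (\<lambda>z0 z1 z2. c i j * (p0 * z0 + q0 * z1 + r0 * z2) ^ i *
      (p1 * z0 + q1 * z1 + r1 * z2) ^ j * (p2 * z0 + q2 * z1 + r2 * z2) ^ (d - i - j))"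
    if "i \<in> {..d}" "j \<in> {..d - i}" for i j
  proof -
    have "is_form (i + (j + (d - i - j + 0))) (\<lambda>z0 z1 z2. (p0 * z0 + q0 * z1 + r0 * z2) ^ i *
        ((p1 * z0 + q1 * z1 + r1 * z2) ^ j * ((p2 * z0 + q2 * z1 + r2 * z2) ^ (d - i - j) * 1)))"
      by (intro is_form_mult_linear_power is_form_1)
    moreover have "i + (j + (d - i - j + 0)) = d"
      using that by simp
    ultimately have "is_form d (\<lambda>z0 z1 z2. c i j * ((p0 * z0 + q0 * z1 + r0 * z2) ^ i *
        ((p1 * z0 + q1 * z1 + r1 * z2) ^ j * ((p2 * z0 + q2 * z1 + r2 * z2) ^ (d - i - j) * 1))))"
      by (intro is_form_scale) simp
    then show ?thesis
      by (simp add: mult.assoc)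
  qed
  then show ?thesis
    unfolding c by (intro is_form_sum)
qed

lemma is_form_linear: "is_form 1 (\<lambda>z0 z1 z2. p * z0 + q * z1 + r * z2)"
  using is_form_mult_linear[OF is_form_1, of p q r] by simp

lemma is_form_1_coeffs:
  assumes "is_form 1 L"
  obtains p q r where "\<And>z0 z1 z2. L z0 z1 z2 = p * z0 + q * z1 + r * z2"
proof -
  obtain c where "\<And>z0 z1 z2. L z0 z1 z2 =
      (\<Sum>i\<le>1. \<Sum>j\<le>1 - i. c i j * z0 ^ i * z1 ^ j * z2 ^ (1 - i - j))"
    using assms unfolding is_form_def by blast
  then have "L z0 z1 z2 = c 1 0 * z0 + c 0 1 * z1 + c 0 0 * z2" for z0 z1 z2
    by simp
  then show ?thesis
    by (rule that)
qed

lemma is_form_2_coeffs: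
  assumes "is_form 2 C"
  obtains \<alpha> \<beta> \<gamma> \<delta> \<epsilon> \<zeta> where "\<And>z0 z1 z2. C z0 z1 z2 =
    \<alpha> * z0 ^ 2 + \<beta> * z0 * z1 + \<gamma> * z1 ^ 2 + \<delta> * z0 * z2 + \<epsilon> * z1 * z2 + \<zeta> * z2 ^ 2"
proof -
  obtain c where "\<And>z0 z1 z2. C z0 z1 z2 =
      (\<Sum>i\<le>2. \<Sum>j\<le>2 - i. c i j * z0 ^ i * z1 ^ j * z2 ^ (2 - i - j))"
    using assms unfolding is_form_def by blast
  then have "C z0 z1 z2 = c 2 0 * z0 ^ 2 + c 1 1 * z0 * z1 + c 0 2 * z1 ^ 2 + c 1 0 * z0 * z2 +
      c 0 1 * z1 * z2 + c 0 0 * z2 ^ 2" for z0 z1 z2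
    by (simp add: numeral_2_eq_2 algebra_simps)
  then show ?thesis
    by (rule that)
qed

lemma binary_quadratic_splits:
  obtains l1 m1 l2 m2 :: complex
  where "\<And>u v. \<alpha> * u ^ 2 + \<beta> * u * v + \<gamma> * v ^ 2 = (l1 * u + m1 * v) * (l2 * u + m2 * v)"
proof (cases "\<alpha> = 0")
  case True
  then show ?thesis
    by (intro that[of 0 1 \<beta> \<gamma>]) (simp add: power2_eq_square algebra_simps)
next
  case False
  define s where "s = csqrt (\<beta> ^ 2 - 4 * \<alpha> * \<gamma>)"
  have s: "s * s = \<beta> * \<beta> - 4 * \<alpha> * \<gamma>"
    using power2_csqrt[of "\<beta> ^ 2 - 4 * \<alpha> * \<gamma>"] by (simp add: s_def power2_eq_square)
  have "\<alpha> * u ^ 2 + \<beta> * u * v + \<gamma> * v ^ 2 =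
      (\<alpha> * u + (\<beta> + s) / 2 * v) * (1 * u + (\<beta> - s) / (2 * \<alpha>) * v)" for u v
  proof -
    have "(\<alpha> * u + (\<beta> + s) / 2 * v) * (1 * u + (\<beta> - s) / (2 * \<alpha>) * v) =
        \<alpha> * u ^ 2 + \<beta> * u * v + (\<beta> * \<beta> - s * s) / (4 * \<alpha>) * v ^ 2"
      using False by (simp add: field_simps power2_eq_square)
    also have "(\<beta> * \<beta> - s * s) / (4 * \<alpha>) = \<gamma>"
      unfolding s using False by simp
    finally show ?thesis by simp
  qed
  then show ?thesis
    by (rule that)
qed

text \<open>Expanded at its singular point, the conic is a binary quadratic form in
  \<open>z0 - p * z2\<close> and \<open>z1 - q * z2\<close>, and such a form splits into linear
  factors.\<close>

lemma singular_conic_reducible: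
  assumes C: "\<And>z0 z1 z2. C z0 z1 z2 =
      \<alpha> * z0 ^ 2 + \<beta> * z0 * z1 + \<gamma> * z1 ^ 2 + \<delta> * z0 * z2 + \<epsilon> * z1 * z2 + \<zeta> * z2 ^ 2"
    and sing: "2 * \<alpha> * p + \<beta> * q + \<delta> = 0" "\<beta> * p + 2 * \<gamma> * q + \<epsilon> = 0" "C p q 1 = 0"
  shows "\<not> irreducible_conic C"
proof -
  have \<delta>: "\<delta> = - 2 * \<alpha> * p - \<beta> * q" and \<epsilon>: "\<epsilon> = - \<beta> * p - 2 * \<gamma> * q"
    using sing(1,2) by (simp_all add: eq_neg_iff_add_eq_0 eq_diff_eq algebra_simps)
  have \<zeta>: "\<zeta> = \<alpha> * p ^ 2 + \<beta> * p * q + \<gamma> * q ^ 2"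
    using sing(3) unfolding C \<delta> \<epsilon> by (simp add: power2_eq_square algebra_simps)
  obtain l1 m1 l2 m2 where split:
    "\<And>u v. \<alpha> * u ^ 2 + \<beta> * u * v + \<gamma> * v ^ 2 = (l1 * u + m1 * v) * (l2 * u + m2 * v)"
    using binary_quadratic_splits by blast
  have lin: "is_form 1 (\<lambda>z0 z1 z2. l * (z0 - p * z2) + m * (z1 - q * z2))" for l m
    using is_form_linear[of l m "- l * p - m * q"] by (simp add: algebra_simps)
  have "C z0 z1 z2 = \<alpha> * (z0 - p * z2) ^ 2 + \<beta> * (z0 - p * z2) * (z1 - q * z2) + \<gamma> * (z1 - q * z2) ^ 2"
    for z0 z1 z2
    unfolding C \<delta> \<epsilon> \<zeta> by (simp add: power2_eq_square algebra_simps)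
  then have "C z0 z1 z2 = (l1 * (z0 - p * z2) + m1 * (z1 - q * z2)) *
      (l2 * (z0 - p * z2) + m2 * (z1 - q * z2))" for z0 z1 z2
    unfolding split .
  then show ?thesis
    unfolding irreducible_conic_def using lin[of l1 m1] lin[of l2 m2] by blast
qed

text \<open>Off the diagonal, Darboux coordinates are local coordinates of the plane: the partial
  derivatives there are \<open>x * G0 - G1\<close> and \<open>y * G0 - G1\<close>, which for
  \<open>x \<noteq> y\<close> vanish together only at a singular point of the conic.\<close>

lemma irreducible_conic_biquad:
  assumes "irreducible_conic C"
  obtains a b c d e g where "\<And>x y. C (x * y) (- (x + y)) 1 = poly (biquad a b c d e g x) y"
    and "\<not> (a = 0 \<and> b = 0 \<and> c = 0 \<and> d = 0 \<and> e = 0 \<and> g = 0)"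
    and "\<And>x y. x \<noteq> y \<Longrightarrow> poly (biquad a b c d e g x) y = 0 \<Longrightarrow>
      poly (pderiv (biquad a b c d e g x)) y = 0 \<Longrightarrow> poly (pderiv (biquad a b c d e g y)) x \<noteq> 0"
proof -
  have form: "is_form 2 C"
    using assms by (simp add: irreducible_conic_def)
  then obtain \<alpha> \<beta> \<gamma> \<delta> \<epsilon> \<zeta> where C: "\<And>z0 z1 z2. C z0 z1 z2 =
    \<alpha> * z0 ^ 2 + \<beta> * z0 * z1 + \<gamma> * z1 ^ 2 + \<delta> * z0 * z2 + \<epsilon> * z1 * z2 + \<zeta> * z2 ^ 2"
    using is_form_2_coeffs by blast
  \<comment> \<open>The signs come from \<open>z1 = - (x + y)\<close>, the summand
    \<open>2 * \<gamma>\<close> from the mixed term of its square.\<close>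
  let ?q = "biquad \<alpha> (- \<beta>) \<gamma> (2 * \<gamma> + \<delta>) (- \<epsilon>) \<zeta>"
  have eq: "C (x * y) (- (x + y)) 1 = poly (?q x) y" for x y
    unfolding C biquad_def by (simp add: power2_eq_square algebra_simps)
  have "\<not> (\<alpha> = 0 \<and> \<beta> = 0 \<and> \<gamma> = 0 \<and> \<delta> = 0 \<and> \<epsilon> = 0 \<and> \<zeta> = 0)"
  proof
    assume "\<alpha> = 0 \<and> \<beta> = 0 \<and> \<gamma> = 0 \<and> \<delta> = 0 \<and> \<epsilon> = 0 \<and> \<zeta> = 0"
    then have "\<forall>z0 z1 z2. C z0 z1 z2 = 0 * 0"
      by (simp add: C)
    then show False
      using assms is_form_0 unfolding irreducible_conic_def by blast
  qed
  then have ne: "\<not> (\<alpha> = 0 \<and> - \<beta> = 0 \<and> \<gamma> = 0 \<and> 2 * \<gamma> + \<delta> = 0 \<and> - \<epsilon> = 0 \<and> \<zeta> = 0)"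
    by auto
  have "poly (pderiv (?q y)) x \<noteq> 0"
    if xy: "x \<noteq> y" "poly (?q x) y = 0" "poly (pderiv (?q x)) y = 0" for x y
  proof
    assume 0: "poly (pderiv (?q y)) x = 0"
    define p q where "p = x * y" and "q = - (x + y)"
    define G0 G1 where "G0 = 2 * \<alpha> * p + \<beta> * q + \<delta>" and "G1 = \<beta> * p + 2 * \<gamma> * q + \<epsilon>"
    have G: "poly (pderiv (?q x)) y = x * G0 - G1" "poly (pderiv (?q y)) x = y * G0 - G1"
      by (simp_all add: poly_pderiv_biquad G0_def G1_def p_def q_def algebra_simps)
    then have "(x - y) * G0 = 0"
      using 0 xy(3) by (simp add: algebra_simps)
    then have "G0 = 0" "G1 = 0"
      using xy(1) 0 G by simp_all
    moreover have "C p q 1 = 0"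
      using eq[of x y] xy(2) by (simp add: p_def q_def)
    ultimately show False
      using singular_conic_reducible[OF C, of p q] assms unfolding G0_def G1_def by blast
  qed
  with eq ne show ?thesis
    by (rule that)
qed

lemma irreducible_conic_linear_subst:
  assumes "irreducible_conic C"
    and inv: "\<And>z0 z1 z2. p0 * (s0 * z0 + t0 * z1 + u0 * z2) + q0 * (s1 * z0 + t1 * z1 + u1 * z2) +
        r0 * (s2 * z0 + t2 * z1 + u2 * z2) = z0"
      "\<And>z0 z1 z2. p1 * (s0 * z0 + t0 * z1 + u0 * z2) + q1 * (s1 * z0 + t1 * z1 + u1 * z2) +
        r1 * (s2 * z0 + t2 * z1 + u2 * z2) = z1"
      "\<And>z0 z1 z2. p2 * (s0 * z0 + t0 * z1 + u0 * z2) + q2 * (s1 * z0 + t1 * z1 + u1 * z2) +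
        r2 * (s2 * z0 + t2 * z1 + u2 * z2) = z2"
  shows "irreducible_conic (\<lambda>z0 z1 z2. C (p0 * z0 + q0 * z1 + r0 * z2) (p1 * z0 + q1 * z1 + r1 * z2)
    (p2 * z0 + q2 * z1 + r2 * z2))"
  unfolding irreducible_conic_def
proof (intro conjI notI)
  show "is_form 2 (\<lambda>z0 z1 z2. C (p0 * z0 + q0 * z1 + r0 * z2) (p1 * z0 + q1 * z1 + r1 * z2)
    (p2 * z0 + q2 * z1 + r2 * z2))"
    using assms(1) unfolding irreducible_conic_def by (intro is_form_linear_subst) blast
  assume "\<exists>L M. is_form 1 L \<and> is_form 1 M \<and> (\<forall>z0 z1 z2.
    C (p0 * z0 + q0 * z1 + r0 * z2) (p1 * z0 + q1 * z1 + r1 * z2) (p2 * z0 + q2 * z1 + r2 * z2) =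
    L z0 z1 z2 * M z0 z1 z2)"
  then obtain L M where LM: "is_form 1 L" "is_form 1 M" "\<And>z0 z1 z2.
    C (p0 * z0 + q0 * z1 + r0 * z2) (p1 * z0 + q1 * z1 + r1 * z2) (p2 * z0 + q2 * z1 + r2 * z2) =
    L z0 z1 z2 * M z0 z1 z2"
    by blast
  note sub = is_form_linear_subst[of 1 _ s0 t0 u0 s1 t1 u1 s2 t2 u2]
  have "\<forall>z0 z1 z2. C z0 z1 z2 =
      L (s0 * z0 + t0 * z1 + u0 * z2) (s1 * z0 + t1 * z1 + u1 * z2) (s2 * z0 + t2 * z1 + u2 * z2) *
      M (s0 * z0 + t0 * z1 + u0 * z2) (s1 * z0 + t1 * z1 + u1 * z2) (s2 * z0 + t2 * z1 + u2 * z2)"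
    unfolding LM(3)[symmetric] inv by simp
  then show False
    using assms(1) sub[OF LM(1)] sub[OF LM(2)] unfolding irreducible_conic_def by blast
qed

section \<open>Moving a generic point to infinity\<close>

lemma pderiv_moebius:
  assumes "degree p \<le> n" "x \<noteq> 0"
  shows "poly (pderiv (moebius_poly n e p)) x =
    of_nat n * x ^ (n - 1) * poly p (e - 1 / x) + x ^ n * poly (pderiv p) (e - 1 / x) / x ^ 2"
proof -
  have "((\<lambda>x. x ^ n * poly p (e - 1 / x)) has_field_derivative
      (of_nat n * x ^ (n - 1) * poly p (e - 1 / x) + x ^ n * poly (pderiv p) (e - 1 / x) / x ^ 2)) (at x)"
    using assms(2) by (auto intro!: derivative_eq_intros simp: field_simps power2_eq_square)
  then have "(poly (moebius_poly n e p) has_field_derivative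
      (of_nat n * x ^ (n - 1) * poly p (e - 1 / x) + x ^ n * poly (pderiv p) (e - 1 / x) / x ^ 2)) (at x)"
    by (rule has_field_derivative_transform_within_open[where S = "- {0}"])
      (use assms in \<open>auto simp: poly_moebius\<close>)
  then show ?thesis
    using poly_DERIV[where p = "moebius_poly n e p" and x = x] DERIV_unique by metis
qed

text \<open>The terms from differentiating \<open>x ^ n\<close> cancel, and the derivative
  \<open>1 / x ^ 2\<close> of \<open>e - 1 / x\<close> lowers the weight from \<open>2 * n\<close>
  to \<open>2 * n - 2\<close>. The minus sign in the substitution avoids a change of sign
  here.\<close>

lemma wronskian_moebius:
  assumes "degree \<phi> = n" "degree f = n" "n \<ge> 1"
  shows "wronskian (moebius_poly n e \<phi>) (moebius_poly n e f) = moebius_poly (2 * n - 2) e (wronskian \<phi> f)"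
proof (rule poly_eqI_nonzero)
  fix x :: complex
  assume x: "x \<noteq> 0"
  have "2 * n - 2 + 2 = 2 * n"
    using assms(3) by simp
  then have "x ^ (2 * n - 2) * x ^ 2 = x ^ (2 * n)"
    by (metis power_add)
  also have "\<dots> = x ^ n * x ^ n"
    by (simp add: mult_2 power_add)
  finally have pow: "x ^ (2 * n - 2) = x ^ n * x ^ n / x ^ 2"
    using x by (simp add: field_simps)
  have "poly (wronskian (moebius_poly n e \<phi>) (moebius_poly n e f)) x =
      x ^ n * x ^ n / x ^ 2 * (poly (pderiv \<phi>) (e - 1 / x) * poly f (e - 1 / x)
        - poly \<phi> (e - 1 / x) * poly (pderiv f) (e - 1 / x))"
    using x assms by (simp add: wronskian_def pderiv_moebius poly_moebius) (simp add: algebra_simps diff_divide_distrib)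
  also have "\<dots> = poly (moebius_poly (2 * n - 2) e (wronskian \<phi> f)) x"
    unfolding poly_moebius[OF degree_wronskian_le[OF assms(1,2)] x] pow by (simp add: wronskian_def)
  finally show "poly (wronskian (moebius_poly n e \<phi>) (moebius_poly n e f)) x =
      poly (moebius_poly (2 * n - 2) e (wronskian \<phi> f)) x" .
qed

lemma smult_moebius_diff:
  assumes "degree \<phi> \<le> n" "degree f \<le> n"
  shows "smult \<alpha> (moebius_poly n e f) - smult \<beta> (moebius_poly n e \<phi>) =
    moebius_poly n e (smult \<alpha> f - smult \<beta> \<phi>)"
proof (rule poly_eqI_nonzero)
  fix x :: complex
  assume x: "x \<noteq> 0"
  have "degree (smult \<alpha> f - smult \<beta> \<phi>) \<le> n"
    using assms degree_smult_le[of \<alpha> f] degree_smult_le[of \<beta> \<phi>] by (intro degree_diff_le) auto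
  then show "poly (smult \<alpha> (moebius_poly n e f) - smult \<beta> (moebius_poly n e \<phi>)) x =
      poly (moebius_poly n e (smult \<alpha> f - smult \<beta> \<phi>)) x"
    using x assms by (simp add: poly_moebius algebra_simps)
qed

lemma pencil_moebius:
  assumes "degree \<phi> \<le> n" "degree f \<le> n"
  shows "pencil (moebius_poly n e \<phi>) (moebius_poly n e f) t = moebius_poly n e (pencil \<phi> f t)"
proof (cases t)
  case (Some s)
  then show ?thesis
    using smult_moebius_diff[OF assms, of s e "- 1"] by (simp add: add.commute)
qed simp

context coprime_pencil
begin

text \<open>Nonvanishing at \<open>e\<close>, the point moved to infinity, keeps both degrees equal
  to \<open>n\<close>. The new point 0 is the old infinity, where neither polynomial vanishes as its
  degree is \<open>n\<close>.\<close>

lemma coprime_pencil_moebius: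
  assumes "poly \<phi> e \<noteq> 0" "poly f e \<noteq> 0"
  shows "coprime_pencil n (moebius_poly n e \<phi>) (moebius_poly n e f)"
proof
  have deg_eq: "degree (moebius_poly n e p) = n" if "degree p = n" "poly p e \<noteq> 0" for p
  proof -
    have "p \<noteq> 0" using that(2) by auto
    then have "\<not> degree (moebius_poly n e p) < n"
      using degree_moebius_less_iff[of p n e] that by simp
    then show ?thesis
      using degree_moebius_le[of p n e] that(1) by simp
  qed
  show "1 \<le> n"
    by (rule n)
  show "degree (moebius_poly n e \<phi>) = n" "degree (moebius_poly n e f) = n"
    using deg_eq deg assms by auto
  show "\<nexists>z. poly (moebius_poly n e \<phi>) z = 0 \<and> poly (moebius_poly n e f) z = 0"
  proof
    assume "\<exists>z. poly (moebius_poly n e \<phi>) z = 0 \<and> poly (moebius_poly n e f) z = 0"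
    then obtain z where z: "poly (moebius_poly n e \<phi>) z = 0" "poly (moebius_poly n e f) z = 0"
      by blast
    show False
    proof (cases "z = 0")
      case True
      have "\<phi> \<noteq> 0"
        using assms by auto
      then show ?thesis
        using z(1) True deg poly_moebius_0[of \<phi> n e] by simp
    next
      case False
      then show ?thesis
        using z deg no_common_zero by (auto simp: poly_moebius)
    qed
  qed
  show "wronskian (moebius_poly n e \<phi>) (moebius_poly n e f) \<noteq> 0"
    using wronskian_ne_0 wronskian_moebius[OF deg n] by (simp add: moebius_eq_0_iff)
qed

end

lemma line_biquad:
  assumes "is_form l L" "l \<le> 1" "\<exists>z0 z1 z2. L z0 z1 z2 \<noteq> 0"
  obtains d e g where "\<And>x y. L (x * y) (- (x + y)) 1 = poly (biquad 0 0 0 d e g x) y"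
    and "\<not> (d = 0 \<and> e = 0 \<and> g = 0)" and "l = 0 \<Longrightarrow> d = 0 \<and> e = 0"
proof (cases "l = 0")
  case True
  then obtain s where s: "\<And>z0 z1 z2. L z0 z1 z2 = s"
    using assms(1) unfolding is_form_def by auto
  show ?thesis
    by (rule that[of 0 0 s]) (use s assms(3) in \<open>auto simp: biquad_def\<close>)
next
  case False
  then have "is_form 1 L"
    using assms(1,2) by (simp add: le_Suc_eq)
  then obtain p q r where L: "\<And>z0 z1 z2. L z0 z1 z2 = p * z0 + q * z1 + r * z2"
    using is_form_1_coeffs by blast
  show ?thesis
    by (rule that[of p "- q" r]) (use L assms(3) False in \<open>auto simp: biquad_def algebra_simps\<close>)
qed

text \<open>Both parities are treated at once: \<open>L\<close> is a line for \<open>l = 1\<close>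
  and a nonzero constant, whose curve is empty, for \<open>l = 0\<close>.\<close>

lemma multiplicities_of_decomposed_curve:
  assumes n: "1 \<le> n" and deg: "degree \<phi> = n" "degree f = n"
    and no_common_zero: "\<nexists>z. poly \<phi> z = 0 \<and> poly f z = 0"
    and S: "poncelet_darboux_form n \<phi> f S" and trans: "transversal_curves S conic_K"
    and C: "\<And>i. i < m \<Longrightarrow> irreducible_conic (C i)"
    and L: "is_form l L" "l \<le> 1" "\<exists>z0 z1 z2. L z0 z1 z2 \<noteq> 0"
    and union: "curve S = (\<Union>i<m. curve (C i)) \<union> curve L"
    and count: "n - 1 = 2 * m + l"
  defines "\<mu> \<equiv> \<lambda>t. gcd_degree n (pencil \<phi> f t)"
  obtains T where "finite T" "\<And>t. t \<notin> T \<Longrightarrow> \<mu> t = 0"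
    "\<And>t. t \<in> T \<Longrightarrow> 1 \<le> \<mu> t \<and> 2 * \<mu> t \<le> n"
    "(\<Sum>t\<in>T. \<mu> t) = 2 * n - 2" "(\<Sum>t\<in>T. \<mu> t * (n - 2 * \<mu> t)) = 4 * m"
proof -
  note w = transversal_imp_proj_roots_wronskian[OF S trans deg n]
  interpret P: coprime_pencil n \<phi> f
    by unfold_locales (use n deg no_common_zero w in auto)
  have sqfree: "rsquarefree P.w"
    using transversal_imp_wronskian_simple[OF S trans] by (auto simp: rsquarefree_roots)
  \<comment> \<open>The point to be moved to infinity must have a fibre of \<open>n\<close> distinct
    finite points, so that the new \<open>through_infinity\<close> has only simple zeros;
    \<open>\<phi>\<close>, \<open>f\<close> and the Wronskian must not vanish there, so that their
    transforms keep full degree.\<close>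
  define B where "B = {a. \<not> (degree (P.through a) = n \<and> card {y. poly (P.through a) y = 0} = n)} \<union>
    {x. poly \<phi> x = 0} \<union> {x. poly f x = 0} \<union> {x. poly P.w x = 0}"
  have "\<phi> \<noteq> 0" "f \<noteq> 0"
    using deg n by auto
  then have "finite B"
    unfolding B_def using P.finite_nongeneric[OF sqfree] w(1) by (simp add: poly_roots_finite)
  then obtain \<epsilon> where "\<epsilon> \<notin> B"
    using ex_new_if_finite[OF infinite_UNIV_char_0[where 'a = complex]] by blast
  then have \<epsilon>: "degree (P.through \<epsilon>) = n" "card {y. poly (P.through \<epsilon>) y = 0} = n"
    "poly \<phi> \<epsilon> \<noteq> 0" "poly f \<epsilon> \<noteq> 0" "poly P.w \<epsilon> \<noteq> 0"
    by (auto simp: B_def)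
  define \<phi>' f' where "\<phi>' = moebius_poly n \<epsilon> \<phi>" and "f' = moebius_poly n \<epsilon> f"
  interpret M: coprime_pencil n \<phi>' f'
    unfolding \<phi>'_def f'_def by (rule P.coprime_pencil_moebius[OF \<epsilon>(3,4)])

  have w': "M.w = moebius_poly (2 * n - 2) \<epsilon> P.w"
    unfolding \<phi>'_def f'_def by (rule wronskian_moebius[OF deg n])
  have deg_w': "degree M.w = 2 * n - 2"
    using degree_moebius_less_iff[OF degree_wronskian_le[OF deg] w(1), of \<epsilon>] \<epsilon>(5)
      degree_moebius_le[OF degree_wronskian_le[OF deg], of \<epsilon>] unfolding w' by simp
  have "proj_roots (2 * n - 2) M.w = 2 * n - 2"
    unfolding w' proj_roots_moebius[OF degree_wronskian_le[OF deg] w(1)] by (rule w(2))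
  then have card_w': "card {x. poly M.w x = 0} = degree M.w"
    by (simp add: proj_roots_def deg_w')
  have sqfree': "rsquarefree M.w"
  proof -
    \<comment> \<open>As many distinct roots as the degree allows: all orders are 1.\<close>
    have "(\<Sum>x | poly M.w x = 0. order x M.w) = (\<Sum>x | poly M.w x = 0. 1)"
      using sum_order_eq_degree[OF M.wronskian_ne_0] card_w' by simp
    moreover have "\<And>x. x \<in> {x. poly M.w x = 0} \<Longrightarrow> 1 \<le> order x M.w"
      using M.wronskian_ne_0 by (auto simp: order_root Suc_le_eq)
    ultimately have "\<forall>x\<in>{x. poly M.w x = 0}. order x M.w = 1"
      using sum_mono_inv[of "\<lambda>_. 1" "{x. poly M.w x = 0}" "\<lambda>x. order x M.w"]
        poly_roots_finite[OF M.wronskian_ne_0] by metis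
    then show ?thesis
      unfolding rsquarefree_def using M.wronskian_ne_0 by (auto simp: order_root)
  qed

  have inf': "M.through_infinity = moebius_poly n \<epsilon> (P.through \<epsilon>)"
    unfolding M.through_infinity_def M.member_def P.through_def P.member_def
    unfolding \<phi>'_def f'_def using deg by (simp add: coeff_moebius smult_moebius_diff)
  have "degree M.through_infinity < n"
    using degree_moebius_less_iff[of "P.through \<epsilon>" n \<epsilon>] \<epsilon>(1) n P.through_ne_0[of \<epsilon>]
    unfolding inf' by (simp add: P.poly_through)
  moreover have "proj_roots n M.through_infinity = n"
    unfolding inf' using proj_roots_moebius[of "P.through \<epsilon>" n \<epsilon>] \<epsilon>(1,2) P.through_ne_0[of \<epsilon>]
    by (simp add: proj_roots_def)
  ultimately have card_inf': "card {x. poly M.through_infinity x = 0} = n - 1"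
    by (simp add: proj_roots_def)

  \<comment> \<open>The linear map of CP^2 induced by the substitution: from the coordinates of the
    point \<open>x\<close>, \<open>y\<close> it yields \<open>x * y\<close> times those of the point
    \<open>\<epsilon> - 1 / x\<close>, \<open>\<epsilon> - 1 / y\<close>. The trivial coefficients
    keep the shape of \<open>is_form_linear_subst\<close>.\<close>
  define sub :: "form \<Rightarrow> form" where
    "sub = (\<lambda>F z0 z1 z2. F (\<epsilon> ^ 2 * z0 + \<epsilon> * z1 + 1 * z2) (- 2 * \<epsilon> * z0 + - 1 * z1 + 0 * z2)
      (1 * z0 + 0 * z1 + 0 * z2))"
  have sub_form: "is_form k (sub F)" if "is_form k F" for k F
    unfolding sub_def by (rule is_form_linear_subst[OF that])
  have sub_inv: "sub F z2 (- z1 - 2 * \<epsilon> * z2) (z0 + \<epsilon> * z1 + \<epsilon> ^ 2 * z2) = F z0 z1 z2" for F z0 z1 z2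
    by (simp add: sub_def power2_eq_square algebra_simps)
  have sub_zero: "sub F (x * y) (- (x + y)) 1 = 0"
    if "is_form k F" "x \<noteq> 0" "y \<noteq> 0"
      "F ((\<epsilon> - 1 / x) * (\<epsilon> - 1 / y)) (- ((\<epsilon> - 1 / x) + (\<epsilon> - 1 / y))) 1 = 0" for F k x y
  proof -
    have eqs: "\<epsilon> ^ 2 * (x * y) + \<epsilon> * (- (x + y)) + 1 * 1 = (x * y) * ((\<epsilon> - 1 / x) * (\<epsilon> - 1 / y))"
      "- 2 * \<epsilon> * (x * y) + - 1 * (- (x + y)) + 0 * 1 = (x * y) * (- ((\<epsilon> - 1 / x) + (\<epsilon> - 1 / y)))"
      "1 * (x * y) + 0 * (- (x + y)) + 0 * 1 = (x * y) * 1"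
      using that(2,3) by (simp_all add: field_simps power2_eq_square)
    then show ?thesis
      unfolding sub_def eqs is_form_homogeneous[OF that(1)] that(4) by simp
  qed
  have sub_conic: "irreducible_conic (sub (C i))" if "i < m" for i
    unfolding sub_def
    by (rule irreducible_conic_linear_subst[OF C[OF that], where ?s0.0 = 0 and ?t0.0 = 0 and ?u0.0 = 1 and
          ?s1.0 = 0 and ?t1.0 = "- 1" and ?u1.0 = "- 2 * \<epsilon>" and
          ?s2.0 = 1 and ?t2.0 = \<epsilon> and ?u2.0 = "\<epsilon> ^ 2"])
      (simp_all add: power2_eq_square algebra_simps)

  \<comment> \<open>One predicate for all requirements on a component, so that its six coefficients
    are chosen together; it is vacuous for \<open>j > m\<close>.\<close>
  define Q where "Q = (\<lambda>j a b c d e g.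
      (j \<le> m \<longrightarrow> (\<forall>x y. sub (if j < m then C j else L) (x * y) (- (x + y)) 1 =
        poly (biquad a b c d e g x) y) \<and> \<not> (a = 0 \<and> b = 0 \<and> c = 0 \<and> d = 0 \<and> e = 0 \<and> g = 0)) \<and>
      (j < m \<longrightarrow> (\<forall>x y. x \<noteq> y \<longrightarrow> poly (biquad a b c d e g x) y = 0 \<longrightarrow>
        poly (pderiv (biquad a b c d e g x)) y = 0 \<longrightarrow> poly (pderiv (biquad a b c d e g y)) x \<noteq> 0)) \<and>
      (j = m \<longrightarrow> a = 0 \<and> b = 0 \<and> c = 0 \<and> (l = 0 \<longrightarrow> d = 0 \<and> e = 0)))"
  have "\<forall>j. \<exists>a b c d e g. Q j a b c d e g"
  proof
    fix j
    consider "j < m" | "j = m" | "m < j" by linarith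
    then show "\<exists>a b c d e g. Q j a b c d e g"
    proof cases
      case 1
      then obtain a b c d e g where *:
        "\<And>x y. sub (C j) (x * y) (- (x + y)) 1 = poly (biquad a b c d e g x) y"
        "\<not> (a = 0 \<and> b = 0 \<and> c = 0 \<and> d = 0 \<and> e = 0 \<and> g = 0)"
        "\<And>x y. x \<noteq> y \<Longrightarrow> poly (biquad a b c d e g x) y = 0 \<Longrightarrow>
          poly (pderiv (biquad a b c d e g x)) y = 0 \<Longrightarrow> poly (pderiv (biquad a b c d e g y)) x \<noteq> 0"
        using irreducible_conic_biquad[OF sub_conic[OF 1]] by blast
      have "Q j a b c d e g"
        using 1 * by (simp add: Q_def)
      then show ?thesis by blast
    next
      case 2
      have "\<exists>z0 z1 z2. sub L z0 z1 z2 \<noteq> 0"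
        using L(3) sub_inv[of L] by metis
      then obtain d e g where *:
        "\<And>x y. sub L (x * y) (- (x + y)) 1 = poly (biquad 0 0 0 d e g x) y"
        "\<not> (d = 0 \<and> e = 0 \<and> g = 0)" "l = 0 \<Longrightarrow> d = 0 \<and> e = 0"
        using line_biquad[OF sub_form[OF L(1)] L(2)] by blast
      have "Q j 0 0 0 d e g"
        using 2 * by (simp add: Q_def)
      then show ?thesis by blast
    qed (simp add: Q_def)
  qed
  then obtain a b c d e g where "\<And>j. Q j (a j) (b j) (c j) (d j) (e j) (g j)"
    by metis
  note coeffs = this[unfolded Q_def]

  interpret D: decomposed_pencil n \<phi>' f' m l a b c d e g
  proof
    fix x y :: complex
    assume xy: "x \<noteq> 0" "y \<noteq> 0" "x \<noteq> y" "poly (M.through x) y = 0"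
    define u v where "u = \<epsilon> - 1 / x" and "v = \<epsilon> - 1 / y"
    have "u \<noteq> v"
      using xy by (simp add: u_def v_def)
    have "poly \<phi>' x * poly f' y - poly f' x * poly \<phi>' y = 0"
      using xy(4) by (simp only: M.poly_through)
    then have "x ^ n * y ^ n * (poly \<phi> u * poly f v - poly \<phi> v * poly f u) = 0"
      unfolding \<phi>'_def f'_def using xy(1,2) deg
      by (simp add: poly_moebius u_def v_def algebra_simps)
    then have "(u - v) * S (u * v) (- (u + v)) 1 = 0"
      using S xy(1,2) by (simp add: poncelet_darboux_form_def)
    then have "(u * v, - (u + v), 1) \<in> curve S"
      using \<open>u \<noteq> v\<close> by (simp add: curve_def)
    then have "(\<exists>j<m. C j (u * v) (- (u + v)) 1 = 0) \<or> L (u * v) (- (u + v)) 1 = 0"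
      unfolding union by (auto simp: curve_def)
    then obtain j where j: "j \<le> m" "(if j < m then C j else L) (u * v) (- (u + v)) 1 = 0"
      by (metis less_imp_le order.refl less_irrefl)
    have "is_form (if j < m then 2 else l) (if j < m then C j else L)"
      using C L(1) by (simp add: irreducible_conic_def)
    then have "sub (if j < m then C j else L) (x * y) (- (x + y)) 1 = 0"
      using xy(1,2) j(2) unfolding u_def v_def by (rule sub_zero)
    then show "\<exists>j\<le>m. poly (biquad (a j) (b j) (c j) (d j) (e j) (g j) x) y = 0"
      using coeffs[of j] j(1) by metis
  next
    fix j and x y :: complex
    assume "j < m" "x \<noteq> y" "poly (biquad (a j) (b j) (c j) (d j) (e j) (g j) x) y = 0"
      "poly (pderiv (biquad (a j) (b j) (c j) (d j) (e j) (g j) x)) y = 0"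
    then show "poly (pderiv (biquad (a j) (b j) (c j) (d j) (e j) (g j) y)) x \<noteq> 0"
      using coeffs[of j] by metis
  next
    fix j
    assume "j \<le> m"
    then show "\<not> (a j = 0 \<and> b j = 0 \<and> c j = 0 \<and> d j = 0 \<and> e j = 0 \<and> g j = 0)"
      using coeffs[of j] by blast
  next
    show "rsquarefree M.w" "degree M.w = 2 * n - 2" "card {x. poly M.through_infinity x = 0} = n - 1"
      "n - 1 = 2 * m + l" "l \<le> 1"
      by (fact sqfree' deg_w' card_inf' count L(2))+
    show "a m = 0" "b m = 0" "c m = 0" "l = 0 \<Longrightarrow> d m = 0 \<and> e m = 0"
      using coeffs[of m] by auto
  qed

  have \<mu>: "\<mu> t = D.mult t" for t
  proof -
    have "proj_roots n (pencil \<phi> f t) = proj_roots n (pencil \<phi>' f' t)"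
      unfolding \<phi>'_def f'_def using deg
      by (simp add: pencil_moebius proj_roots_moebius[OF P.degree_pencil_le P.pencil_ne_0])
    then show ?thesis
      using D.proj_roots_pencil[of t] gcd_degree_add_proj_roots[OF P.pencil_ne_0 P.degree_pencil_le, of t]
      unfolding \<mu>_def by linarith
  qed
  show ?thesis
  proof (rule that[of D.branch])
    show "finite D.branch"
      by (rule D.finite_branch)
    show "\<mu> t = 0" if "t \<notin> D.branch" for t
      using that D.mult_pos_iff[of t] by (simp add: \<mu>)
    show "1 \<le> \<mu> t \<and> 2 * \<mu> t \<le> n" if "t \<in> D.branch" for t
      using that D.mult_pos_iff[of t] D.card_simple_roots(2)[OF that] by (simp add: \<mu> Suc_le_eq)
    show "(\<Sum>t\<in>D.branch. \<mu> t) = 2 * n - 2"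
      unfolding \<mu> by (rule D.sum_mult)
    show "(\<Sum>t\<in>D.branch. \<mu> t * (n - 2 * \<mu> t)) = 4 * m"
      unfolding \<mu> by (rule D.sum_mult_simple)
  qed
qed

text \<open>The alternative for \<open>k = 4\<close> does occur. Let h be a generic map of degree 2
  from CP^1 to itself and q the quotient by a Klein four-group V. For the pencil of q o h the curve
  consists of the line h(x) = h(y) and the three conics h(x) = v(h(y)) with v in V, v not the
  identity. The multiplicities are 4, 4, 4 at the branch values of q and 1, 1 at the q-images of
  those of h.\<close>

theorem theorem9:
  fixes n :: nat and \<phi> f :: "complex poly" and S :: form
  assumes "1 \<le> n"
    and "degree \<phi> = n"
    and "degree f = n"
    and "\<nexists>z. poly \<phi> z = 0 \<and> poly f z = 0"
    and "poncelet_darboux_form n \<phi> f S"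
    and "transversal_curves S conic_K"
  shows
    "(\<forall>k. n = 2 * k + 1 \<and> is_union_of_conics S k \<longrightarrow>
        (\<exists>t1 t2 t3 t4. distinct [t1, t2, t3, t4] \<and>
           gcd_degree n (pencil \<phi> f t1) = k \<and>
           gcd_degree n (pencil \<phi> f t2) = k \<and>
           gcd_degree n (pencil \<phi> f t3) = k \<and>
           gcd_degree n (pencil \<phi> f t4) = k)) \<and>
     (\<forall>k. n = 2 * k \<and> is_union_of_conics_and_line S (k - 1) \<longrightarrow>
        (\<exists>t1 t2 t3 t4. distinct [t1, t2, t3, t4] \<and>
           gcd_degree n (pencil \<phi> f t1) = k \<and>
           gcd_degree n (pencil \<phi> f t2) = k \<and>
           gcd_degree n (pencil \<phi> f t3) = k - 1 \<and>
           gcd_degree n (pencil \<phi> f t4) = k - 1) \<or>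
        (k = 4 \<and>
         (\<exists>t1 t2 t3 t4 t5. distinct [t1, t2, t3, t4, t5] \<and>
            gcd_degree n (pencil \<phi> f t1) = 4 \<and>
            gcd_degree n (pencil \<phi> f t2) = 4 \<and>
            gcd_degree n (pencil \<phi> f t3) = 4 \<and>
            gcd_degree n (pencil \<phi> f t4) = 1 \<and>
            gcd_degree n (pencil \<phi> f t5) = 1)))"
proof (intro conjI allI impI; elim conjE)
  have inf: "infinite (UNIV :: complex option set)"
    by (simp add: finite_option_UNIV infinite_UNIV_char_0)
  note multiplicities = multiplicities_of_decomposed_curve[OF assms]
  {
    fix k
    assume k: "n = 2 * k + 1" and "is_union_of_conics S k"
    then obtain C where C: "\<And>i. i < k \<Longrightarrow> irreducible_conic (C i)"
      and union: "curve S = (\<Union>i<k. curve (C i))"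
      unfolding is_union_of_conics_def by blast
    obtain T where "finite T" "\<And>t. t \<notin> T \<Longrightarrow> gcd_degree n (pencil \<phi> f t) = 0"
      "\<And>t. t \<in> T \<Longrightarrow> 1 \<le> gcd_degree n (pencil \<phi> f t) \<and> 2 * gcd_degree n (pencil \<phi> f t) \<le> n"
      "(\<Sum>t\<in>T. gcd_degree n (pencil \<phi> f t)) = 2 * n - 2"
      "(\<Sum>t\<in>T. gcd_degree n (pencil \<phi> f t) * (n - 2 * gcd_degree n (pencil \<phi> f t))) = 4 * k"
      using multiplicities[where C = C and m = k and l = 0 and L = "\<lambda>_ _ _. 1", OF C is_form_1]
        union k by (auto simp: curve_def)
    then show "\<exists>t1 t2 t3 t4. distinct [t1, t2, t3, t4] \<and>
        gcd_degree n (pencil \<phi> f t1) = k \<and> gcd_degree n (pencil \<phi> f t2) = k \<and>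
        gcd_degree n (pencil \<phi> f t3) = k \<and> gcd_degree n (pencil \<phi> f t4) = k"
      using k by (intro four_values_odd[OF inf]) auto
  next
    fix k
    assume k: "n = 2 * k" and "is_union_of_conics_and_line S (k - 1)"
    then obtain C L where C: "\<And>i. i < k - 1 \<Longrightarrow> irreducible_conic (C i)" and L: "is_line L"
      and union: "curve S = (\<Union>i<k - 1. curve (C i)) \<union> curve L"
      unfolding is_union_of_conics_and_line_def by blast
    have k1: "1 \<le> k"
      using k assms(1) by simp
    then have count: "n - 1 = 2 * (k - 1) + 1"
      using k by simp
    have L': "is_form 1 L" "\<exists>z0 z1 z2. L z0 z1 z2 \<noteq> 0"
      using L by (auto simp: is_line_def)
    obtain T where "finite T" "\<And>t. t \<notin> T \<Longrightarrow> gcd_degree n (pencil \<phi> f t) = 0"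
      "\<And>t. t \<in> T \<Longrightarrow> 1 \<le> gcd_degree n (pencil \<phi> f t) \<and> 2 * gcd_degree n (pencil \<phi> f t) \<le> n"
      "(\<Sum>t\<in>T. gcd_degree n (pencil \<phi> f t)) = 2 * n - 2"
      "(\<Sum>t\<in>T. gcd_degree n (pencil \<phi> f t) * (n - 2 * gcd_degree n (pencil \<phi> f t))) = 4 * (k - 1)"
      using multiplicities[OF C L'(1) order.refl L'(2) union count] by blast
    then show "(\<exists>t1 t2 t3 t4. distinct [t1, t2, t3, t4] \<and>
        gcd_degree n (pencil \<phi> f t1) = k \<and> gcd_degree n (pencil \<phi> f t2) = k \<and>
        gcd_degree n (pencil \<phi> f t3) = k - 1 \<and> gcd_degree n (pencil \<phi> f t4) = k - 1) \<or>
      (k = 4 \<and> (\<exists>t1 t2 t3 t4 t5. distinct [t1, t2, t3, t4, t5] \<and>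
        gcd_degree n (pencil \<phi> f t1) = 4 \<and> gcd_degree n (pencil \<phi> f t2) = 4 \<and>
        gcd_degree n (pencil \<phi> f t3) = 4 \<and> gcd_degree n (pencil \<phi> f t4) = 1 \<and>
        gcd_degree n (pencil \<phi> f t5) = 1))"
      using k k1 by (intro four_or_five_values_even[OF inf]) auto
  }
qed

end
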